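(* Let $B$ be a finite subset of $\mathrm{L}$. Then $\mathrm{SAT}(\{\mathsf{X}\},B)$ can be decided in polynomial time.
   Context: A Boolean function is a map $f:\{0,1\}^n\to\{0,1\}$; each is used as an $n$-ary propositional connective. $\mathrm{L}$ is the set of linear Boolean functions, i.e. those of the form $f(x_1,\dots,x_n)=x_{i_1}\oplus\dots\oplus x_{i_k}\oplus c$ for some variables among $x_1,\dots,x_n$ and a constant $c\in\{0,1\}$, where $\oplus$ is exclusive or. A temporal $B$-formula over $\{\mathsf{X}\}$ is built from propositional variables using connectives from $B$ and the unary operator $\mathsf{X}$. A structure $S=(s,V,\xi)$ is an infinite sequence $(s_i)_{i\in\mathbb N}$ of distinct states, a variable set $V$, and $\xi$ assigning to each state the set of variables true there. Semantics: $S,s_i\models x$ iff $x\in\xi(s_i)$; Boolean connectives pointwise; $S,s_i\models\mathsf{X}\varphi$ iff $S,s_{i+1}\models\varphi$. A formula is satisfiable if it holds at some state of some structure. $\mathrm{SAT}(\{\mathsf{X}\},B)$ is the problem of deciding satisfiability of temporal $B$-formulae over $\{\mathsf{X}\}$. *)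

theory Defs
  imports Main "HOL-Library.FuncSet" "HOL-Computational_Algebra.Polynomial"
begin

section \<open>Boolean functions\<close>

text \<open>A Boolean function carries its arity. It is extensional, i.e. it has a fixed dummy value
  outside \<open>{0,1}\<^sup>n\<close>, so that equality is equality of Boolean functions.\<close>

type_synonym boolfun = "nat \<times> (bool list \<Rightarrow> bool)"

definition boolfuns :: "boolfun set" where
  "boolfuns = (SIGMA n:UNIV. {xs. length xs = n} \<rightarrow>\<^sub>E UNIV)"

text \<open>On \<open>bool\<close>, disequality is exclusive or.\<close>

definition linear_boolfuns :: "boolfun set" where
  "linear_boolfuns = {(n, f) \<in> boolfuns.
     \<exists>js c. set js \<subseteq> {..<n} \<and>
       (\<forall>xs. length xs = n \<longrightarrow> f xs = foldr (\<lambda>j b. xs ! j \<noteq> b) js c)}"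

section \<open>Temporal formulae over X\<close>

datatype 'v fm = Var 'v | Conn boolfun "'v fm list" | Next "'v fm"

inductive_set formulae :: "boolfun set \<Rightarrow> 'v fm set" for B where
  "Var x \<in> formulae B"
| "\<phi> \<in> formulae B \<Longrightarrow> Next \<phi> \<in> formulae B"
| "f \<in> B \<Longrightarrow> length \<phi>s = fst f \<Longrightarrow> \<forall>\<phi>\<in>set \<phi>s. \<phi> \<in> formulae B \<Longrightarrow> Conn f \<phi>s \<in> formulae B"

inductive_cases Conn_formulaeE: "Conn f \<phi>s \<in> formulae B"

record ('s, 'v) struct =
  state_seq :: "nat \<Rightarrow> 's"
  var_set :: "'v set"
  labelling :: "'s \<Rightarrow> 'v set"

definition is_struct :: "('s, 'v) struct \<Rightarrow> bool" where
  "is_struct S \<longleftrightarrow> inj (state_seq S) \<and> (\<forall>i. labelling S (state_seq S i) \<subseteq> var_set S)"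

fun models :: "('s, 'v) struct \<Rightarrow> nat \<Rightarrow> 'v fm \<Rightarrow> bool" where
  "models S i (Var x) \<longleftrightarrow> x \<in> labelling S (state_seq S i)"
| "models S i (Conn f \<phi>s) \<longleftrightarrow> snd f (map (models S i) \<phi>s)"
| "models S i (Next \<phi>) \<longleftrightarrow> models S (Suc i) \<phi>"

text \<open>States are taken from \<open>nat\<close>; by \<open>satisfiableI\<close> below, structures over any other type of
  states satisfy no further formulae.\<close>

definition satisfiable :: "'v fm \<Rightarrow> bool" where
  "satisfiable \<phi> \<longleftrightarrow> (\<exists>(S :: (nat, 'v) struct) i. is_struct S \<and> models S i \<phi>)"

lemma satisfiableI:
  fixes S :: "('s, 'v) struct"
  assumes "is_struct S" "models S i \<phi>"
  shows "satisfiable \<phi>"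
proof -
  define T :: "(nat, 'v) struct" where
    "T = \<lparr>state_seq = id, var_set = var_set S, labelling = labelling S \<circ> state_seq S\<rparr>"
  have "models T j \<psi> \<longleftrightarrow> models S j \<psi>" for j \<psi>
  proof (induction \<psi> arbitrary: j)
    case (Conn f \<phi>s)
    then have "map (models T j) \<phi>s = map (models S j) \<phi>s" by simp
    then show ?case by (simp only: models.simps)
  qed (simp_all add: T_def)
  moreover have "is_struct T"
    using assms(1) by (simp add: is_struct_def T_def)
  ultimately show ?thesis
    using assms(2) unfolding satisfiable_def by blast
qed

section \<open>Satisfiability as a language\<close>

text \<open>Variable names are binary words. Formulae are written in Polish notation over an alphabet
  with one letter for each connective; \<open>VarSym\<close> introduces the name of a variable, which extends
  up to the next symbol that is not a bit.\<close>

type_synonym var = "bool list"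

datatype symbol = ConnSym boolfun | NextSym | VarSym | BitSym bool

definition symbols :: "boolfun set \<Rightarrow> symbol set" where
  "symbols B = ConnSym ` B \<union> {NextSym, VarSym} \<union> range BitSym"

fun encode :: "var fm \<Rightarrow> symbol list" where
  "encode (Var x) = VarSym # map BitSym x"
| "encode (Conn f \<phi>s) = ConnSym f # concat (map encode \<phi>s)"
| "encode (Next \<phi>) = NextSym # encode \<phi>"

definition SAT_X :: "boolfun set \<Rightarrow> symbol list set" where
  "SAT_X B = {encode \<phi> | \<phi>. \<phi> \<in> formulae B \<and> satisfiable \<phi>}"

definition no_bit :: "symbol list \<Rightarrow> bool" where
  "no_bit u \<longleftrightarrow> (\<forall>b v. u \<noteq> BitSym b # v)"

lemma no_bit_encode: "no_bit (encode \<phi> @ u)"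
  by (cases \<phi>) (simp_all add: no_bit_def)

lemma no_bit_concat: "no_bit u \<Longrightarrow> no_bit (concat (map encode \<phi>s) @ u)"
  by (cases \<phi>s) (simp_all add: no_bit_encode)

lemma bits_append_eq:
  "map BitSym x @ u = map BitSym y @ v \<Longrightarrow> no_bit u \<Longrightarrow> no_bit v \<Longrightarrow> x = y \<and> u = v"
proof (induction x arbitrary: y)
  case Nil
  then show ?case by (cases y) (auto simp: no_bit_def)
next
  case (Cons a x)
  then show ?case by (cases y) (auto simp: no_bit_def)
qed

lemma encode_append_eq:
  "\<phi> \<in> formulae B \<Longrightarrow> \<psi> \<in> formulae B \<Longrightarrow> no_bit u \<Longrightarrow> no_bit v \<Longrightarrow>
   encode \<phi> @ u = encode \<psi> @ v \<Longrightarrow> \<phi> = \<psi> \<and> u = v"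
proof (induction \<phi> arbitrary: \<psi> u v)
  case (Var x)
  then show ?case by (cases \<psi>) (auto dest: bits_append_eq)
next
  case (Next \<phi>)
  from Next.prems(5) obtain \<chi> where \<psi>: "\<psi> = Next \<chi>" by (cases \<psi>) auto
  have "\<phi> \<in> formulae B" "\<chi> \<in> formulae B"
    using Next.prems(1,2) unfolding \<psi> by (auto elim: formulae.cases)
  then have "\<phi> = \<chi> \<and> u = v"
    using Next.prems \<psi> by (intro Next.IH) auto
  then show ?case by (simp add: \<psi>)
next
  case (Conn f \<phi>s)
  from Conn.prems(5) obtain \<psi>s where \<psi>: "\<psi> = Conn f \<psi>s" by (cases \<psi>) auto
  have "length \<phi>s = fst f" "length \<psi>s = fst f" and
    \<phi>s: "\<forall>\<chi>\<in>set \<phi>s. \<chi> \<in> formulae B" and \<psi>s: "\<forall>\<chi>\<in>set \<psi>s. \<chi> \<in> formulae B"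
    using Conn.prems(1,2) unfolding \<psi> by (auto elim!: Conn_formulaeE)
  then have len: "length \<phi>s = length \<psi>s" by simp
  have "concat (map encode \<phi>s) @ u = concat (map encode \<psi>s) @ v"
    using Conn.prems(5) \<psi> by simp
  with len Conn.IH \<phi>s \<psi>s have "\<phi>s = \<psi>s \<and> u = v"
  proof (induction \<phi>s \<psi>s rule: list_induct2)
    case Nil
    then show ?case by simp
  next
    case (Cons \<phi> \<phi>s \<psi> \<psi>s)
    have "encode \<phi> @ concat (map encode \<phi>s) @ u = encode \<psi> @ concat (map encode \<psi>s) @ v"
      using Cons.prems(4) by simp
    from Cons.prems(1)[OF _ _ _ _ _ this]
    have hd: "\<phi> = \<psi> \<and> concat (map encode \<phi>s) @ u = concat (map encode \<psi>s) @ v"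
      using Cons.prems(2,3) Conn.prems(3,4) by (simp add: no_bit_concat)
    have "\<phi>s = \<psi>s \<and> u = v"
    proof (rule Cons.IH)
      show "\<chi> = \<psi>' \<and> u' = v'"
        if "\<chi> \<in> set \<phi>s" "\<chi> \<in> formulae B" "\<psi>' \<in> formulae B" "no_bit u'" "no_bit v'"
          "encode \<chi> @ u' = encode \<psi>' @ v'" for \<chi> \<psi>' u' v'
        by (rule Cons.prems(1)[OF _ that(2-6)]) (simp add: that(1))
    qed (use Cons.prems(2,3) hd in simp_all)
    with hd show ?case by simp
  qed
  then show ?case by (simp add: \<psi>)
qed

lemma inj_on_encode: "inj_on encode (formulae B)"
  using encode_append_eq[where u = "[]" and v = "[]"]
  by (auto simp: inj_on_def no_bit_def)

section \<open>Polynomial time\<close>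

text \<open>Deterministic Turing machines with finitely many two-way infinite tapes. The first tape
  initially holds the input. A head move is \<open>-1\<close>, \<open>0\<close> or \<open>1\<close>.\<close>

datatype 'a tsym = Blank | Inp 'a | Aux nat

record ('q, 'a) tm =
  tape_count :: nat
  tm_states :: "'q set"
  tm_alphabet :: "'a tsym set"
  start_state :: 'q
  accept_state :: 'q
  reject_state :: 'q
  transition :: "'q \<Rightarrow> 'a tsym list \<Rightarrow> 'q \<times> ('a tsym \<times> int) list"

definition is_tm :: "'a set \<Rightarrow> ('q, 'a) tm \<Rightarrow> bool" where
  "is_tm \<Sigma> M \<longleftrightarrow>
     tape_count M \<ge> 1 \<and> finite (tm_states M) \<and> finite (tm_alphabet M) \<and>
     insert Blank (Inp ` \<Sigma>) \<subseteq> tm_alphabet M \<and>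
     {start_state M, accept_state M, reject_state M} \<subseteq> tm_states M \<and>
     accept_state M \<noteq> reject_state M \<and>
     (\<forall>q\<in>tm_states M. \<forall>as\<in>lists (tm_alphabet M). length as = tape_count M \<longrightarrow>
        (case transition M q as of (q', acts) \<Rightarrow>
           q' \<in> tm_states M \<and> length acts = tape_count M \<and>
           set acts \<subseteq> tm_alphabet M \<times> {-1, 0, 1}))"

text \<open>A tape is given by its contents and the position of the head.\<close>

type_synonym 'a tape = "(int \<Rightarrow> 'a tsym) \<times> int"

definition read_tape :: "'a tape \<Rightarrow> 'a tsym" where
  "read_tape t = fst t (snd t)"

definition act_tape :: "'a tape \<Rightarrow> 'a tsym \<times> int \<Rightarrow> 'a tape" where
  "act_tape t act = ((fst t)(snd t := fst act), snd t + snd act)"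

definition tm_step :: "('q, 'a) tm \<Rightarrow> 'q \<times> 'a tape list \<Rightarrow> 'q \<times> 'a tape list" where
  "tm_step M cfg = (case cfg of (q, ts) \<Rightarrow>
     if q \<in> {accept_state M, reject_state M} then (q, ts)
     else (case transition M q (map read_tape ts) of (q', acts) \<Rightarrow> (q', map2 act_tape ts acts)))"

definition tm_init :: "('q, 'a) tm \<Rightarrow> 'a list \<Rightarrow> 'q \<times> 'a tape list" where
  "tm_init M w =
     (start_state M,
      (\<lambda>i. if 0 \<le> i \<and> i < int (length w) then Inp (w ! nat i) else Blank, 0) #
      replicate (tape_count M - 1) (\<lambda>_. Blank, 0))"

definition decides_in_time ::
    "('q, 'a) tm \<Rightarrow> 'a set \<Rightarrow> 'a list set \<Rightarrow> (nat \<Rightarrow> nat) \<Rightarrow> bool" where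
  "decides_in_time M \<Sigma> L T \<longleftrightarrow>
     (\<forall>w\<in>lists \<Sigma>. \<exists>t\<le>T (length w).
        fst ((tm_step M ^^ t) (tm_init M w)) =
          (if w \<in> L then accept_state M else reject_state M))"

definition poly_time_decidable :: "'a set \<Rightarrow> 'a list set \<Rightarrow> bool" where
  "poly_time_decidable \<Sigma> L \<longleftrightarrow>
     finite \<Sigma> \<and> L \<subseteq> lists \<Sigma> \<and>
     (\<exists>(M :: (nat, 'a) tm) (p :: nat poly). is_tm \<Sigma> M \<and> decides_in_time M \<Sigma> L (poly p))"

end

theory Submission imports Defs begin

text \<open>Over linear connectives, a formula is equivalent to the exclusive or of a constant and of
  atoms \<open>X\<^sup>d x\<close>, because \<open>X\<close> commutes with exclusive or. It is unsatisfiable iff the constant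
  is 0 and every atom cancels: if some atom \<open>X\<^sup>d x\<close> survives, the all-false structure and the one
  where only \<open>x\<close> at time \<open>d\<close> is true give different values. One pass over the Polish notation
  with a stack of pending subformulae computes the surviving atoms, each new atom being added
  to, or cancelled from, the current list. A machine with several tapes does this in cubic time;
  it is written in a small while-language whose variables are stacks.\<close>

section \<open>While programs on stacks\<close>

text \<open>Linear forms of subformulae are never computed. Coefficients are pushed from the root to
  the leaves instead: an atom counts iff all coefficients on the path to it are 1, so a pending
  subformula needs only one bit, and the number of enclosing \<open>Next\<close> is the time shift
  of the atom. The obstacle is the concrete machine model. A control state of the machine is the
  program still to be executed. Only finitely many such programs arise, because a branch ranges over
  the finite tape alphabet, and each small step of a program is one machine step, so time bounds for
  programs carry over unchanged. An empty stack and a \<open>Blank\<close> on top look alike; hence,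
  except in the middle of a push, the stacks hold no blanks, and \<open>Blank\<close> on top means
  empty. The cubic bound arises as follows: there are linearly many atoms, each written with
  linearly many letters, so the stored list has quadratic length, and it is scanned once per
  variable occurrence.\<close>

datatype 'a com =
    Skip
  | Halt bool
  | Push nat "'a tsym"
  | Put nat "'a tsym"
  | Pop nat
  | Seq "'a com" "'a com" (infixr ";;" 60)
  | Branch nat "'a tsym \<Rightarrow> 'a com"
  | While nat "'a tsym \<Rightarrow> bool" "'a com"

text \<open>A machine step writes before it moves, so a push takes two steps:
  \<open>PushBlank\<close> moves left onto a fresh cell and \<open>SetTop\<close>, issued by
  \<open>Put\<close>, fills it.\<close>

datatype 'a stack_op = Nop | PushBlank nat | SetTop nat "'a tsym" | Drop nat

text \<open>\<open>Halt\<close> steps to itself and never becomes \<open>Skip\<close>, so it also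
  blocks whatever is sequenced after it.\<close>

primrec next_op :: "'a com \<Rightarrow> (nat \<Rightarrow> 'a tsym) \<Rightarrow> 'a com \<times> 'a stack_op" where
  "next_op Skip r = (Skip, Nop)"
| "next_op (Halt b) r = (Halt b, Nop)"
| "next_op (Push i a) r = (Put i a, PushBlank i)"
| "next_op (Put i a) r = (Skip, SetTop i a)"
| "next_op (Pop i) r = (Skip, Drop i)"
| "next_op (c ;; d) r =
     (if c = Skip then (d, Nop) else (fst (next_op c r) ;; d, snd (next_op c r)))"
| "next_op (Branch i g) r = (g (r i), Nop)"
| "next_op (While i P c) r = (if P (r i) then c ;; While i P c else Skip, Nop)"

type_synonym 'a stacks = "nat \<Rightarrow> 'a tsym list"

definition stack_top :: "'a tsym list \<Rightarrow> 'a tsym" where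
  "stack_top xs = (case xs of [] \<Rightarrow> Blank | x # _ \<Rightarrow> x)"

lemma stack_top_simps [simp]: "stack_top [] = Blank" "stack_top (x # xs) = x"
  by (simp_all add: stack_top_def)

primrec apply_op :: "'a stack_op \<Rightarrow> 'a stacks \<Rightarrow> 'a stacks" where
  "apply_op Nop s = s"
| "apply_op (PushBlank i) s = s(i := Blank # s i)"
| "apply_op (SetTop i a) s = s(i := a # tl (s i))"
| "apply_op (Drop i) s = s(i := tl (s i))"

definition com_step :: "'a com \<times> 'a stacks \<Rightarrow> 'a com \<times> 'a stacks" where
  "com_step cs =
     (case next_op (fst cs) (\<lambda>i. stack_top (snd cs i)) of (c', a) \<Rightarrow> (c', apply_op a (snd cs)))"

definition reaches ::
    "'a com \<Rightarrow> 'a stacks \<Rightarrow> nat \<Rightarrow> 'a com \<Rightarrow> 'a stacks \<Rightarrow> bool" where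
  "reaches c s T c' s' \<longleftrightarrow> (\<exists>t\<le>T. (com_step ^^ t) (c, s) = (c', s'))"

lemma reaches_mono: "reaches c s T c' s' \<Longrightarrow> T \<le> T' \<Longrightarrow> reaches c s T' c' s'"
  unfolding reaches_def by (meson order.trans)

lemma reaches_refl: "reaches c s T c s"
  unfolding reaches_def by (rule exI[of _ 0]) simp

lemma reaches_trans:
  assumes "reaches c s T1 c1 s1" "reaches c1 s1 T2 c2 s2" "T1 + T2 \<le> T"
  shows "reaches c s T c2 s2"
proof -
  obtain t1 t2 where "t1 \<le> T1" "(com_step ^^ t1) (c, s) = (c1, s1)"
    "t2 \<le> T2" "(com_step ^^ t2) (c1, s1) = (c2, s2)"
    using assms(1,2) unfolding reaches_def by blast
  then show ?thesis
    unfolding reaches_def using assms(3)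
    by (intro exI[of _ "t2 + t1"]) (simp add: funpow_add)
qed

lemma reaches_step:
  assumes "com_step (c, s) = (c1, s1)" "reaches c1 s1 T c2 s2" "Suc T \<le> T'"
  shows "reaches c s T' c2 s2"
proof (rule reaches_trans)
  show "reaches c s 1 c1 s1"
    unfolding reaches_def using assms(1) by (intro exI[of _ 1]) simp
qed (use assms in auto)

lemma reaches_Seq_left:
  assumes "reaches c s T Skip s'"
  shows "reaches (c ;; d) s T (Skip ;; d) s'"
proof -
  have "\<exists>t'\<le>t. (com_step ^^ t') (c ;; d, s) = (Skip ;; d, s')"
    if "(com_step ^^ t) (c, s) = (Skip, s')" for t
    using that
  proof (induction t arbitrary: c s)
    case 0
    then show ?case by simp
  next
    case (Suc t)
    show ?case
    proof (cases "c = Skip")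
      case True
      \<comment> \<open>\<open>Skip\<close> alone idles whereas \<open>Skip ;; d\<close> would move
        on, so the composed run must be cut at the first arrival in \<open>Skip\<close>; this is why
        only some \<open>t' \<le> t\<close> is claimed.\<close>
      have skip: "(com_step ^^ k) (Skip, s) = (Skip, s)" for k
        by (induction k) (auto simp: com_step_def)
      have "s' = s" using Suc.prems True skip[of "Suc t"] by simp
      then show ?thesis using True by (intro exI[of _ 0]) simp
    next
      case False
      obtain c1 s1 where c1: "com_step (c, s) = (c1, s1)" by fastforce
      then have "(com_step ^^ t) (c1, s1) = (Skip, s')"
        using Suc.prems by (simp add: funpow_Suc_right del: funpow.simps)
      from Suc.IH[OF this] obtain t' where
        "t' \<le> t" "(com_step ^^ t') (c1 ;; d, s1) = (Skip ;; d, s')" by blast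
      moreover have "com_step (c ;; d, s) = (c1 ;; d, s1)"
        using False c1 by (auto simp: com_step_def split: prod.splits)
      ultimately show ?thesis
        by (intro exI[of _ "Suc t'"]) (simp add: funpow_Suc_right del: funpow.simps)
    qed
  qed
  then show ?thesis
    using assms unfolding reaches_def by (meson order.trans)
qed

lemma reaches_Seq:
  assumes "reaches c s T1 Skip s1" "reaches d s1 T2 c' s2"
  shows "reaches (c ;; d) s (T1 + T2 + 1) c' s2"
  by (rule reaches_trans[OF reaches_Seq_left[OF assms(1)] reaches_step[OF _ assms(2) order_refl]])
     (simp_all add: com_step_def)

lemma reaches_Push: "reaches (Push i a) s 2 Skip (s(i := a # s i))"
  unfolding reaches_def by (intro exI[of _ 2]) (simp add: com_step_def numeral_2_eq_2)

lemma reaches_Pop: "reaches (Pop i) s 1 Skip (s(i := tl (s i)))"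
  unfolding reaches_def by (intro exI[of _ 1]) (simp add: com_step_def)

lemma reaches_Branch:
  assumes "reaches (g (stack_top (s i))) s T c' s'"
  shows "reaches (Branch i g) s (T + 1) c' s'"
  by (rule reaches_step[OF _ assms]) (simp_all add: com_step_def)

lemma reaches_While_False:
  "\<not> P (stack_top (s i)) \<Longrightarrow> reaches (While i P c) s 1 Skip s"
  by (rule reaches_step[OF _ reaches_refl[where T = 0]]) (simp_all add: com_step_def)

lemma reaches_While_True:
  assumes "P (stack_top (s i))" "reaches c s T1 Skip s1" "reaches (While i P c) s1 T2 c' s2"
  shows "reaches (While i P c) s (T1 + T2 + 2) c' s2"
  by (rule reaches_step[OF _ reaches_Seq[OF assms(2,3)]])
     (use assms in \<open>simp_all add: com_step_def\<close>)

lemma reaches_weaken: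
  "reaches c s T c' s' \<Longrightarrow> s' = s'' \<Longrightarrow> T \<le> T' \<Longrightarrow> reaches c s T' c' s''"
  using reaches_mono by blast

section \<open>Residual programs as a finite set of states\<close>

primrec wf_com :: "nat \<Rightarrow> 'a tsym set \<Rightarrow> 'a com \<Rightarrow> bool" where
  "wf_com k \<Gamma> Skip \<longleftrightarrow> True"
| "wf_com k \<Gamma> (Halt b) \<longleftrightarrow> True"
| "wf_com k \<Gamma> (Push i a) \<longleftrightarrow> i < k \<and> a \<in> \<Gamma>"
| "wf_com k \<Gamma> (Put i a) \<longleftrightarrow> i < k \<and> a \<in> \<Gamma>"
| "wf_com k \<Gamma> (Pop i) \<longleftrightarrow> i < k"
| "wf_com k \<Gamma> (c ;; d) \<longleftrightarrow> wf_com k \<Gamma> c \<and> wf_com k \<Gamma> d"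
| "wf_com k \<Gamma> (Branch i g) \<longleftrightarrow> i < k \<and> (\<forall>a\<in>\<Gamma>. wf_com k \<Gamma> (g a))"
| "wf_com k \<Gamma> (While i P c) \<longleftrightarrow> i < k \<and> wf_com k \<Gamma> c"

text \<open>A set closed under \<open>next_op\<close> that contains every program into which
  \<open>c\<close> can evolve. Restricting the branches to letters of \<open>\<Gamma>\<close> keeps
  it finite, although \<open>g\<close> is defined on an infinite type.\<close>

primrec derivs :: "'a tsym set \<Rightarrow> 'a com \<Rightarrow> 'a com set" where
  "derivs \<Gamma> Skip = {Skip}"
| "derivs \<Gamma> (Halt b) = {Halt b}"
| "derivs \<Gamma> (Push i a) = {Push i a, Put i a, Skip}"
| "derivs \<Gamma> (Put i a) = {Put i a, Skip}"
| "derivs \<Gamma> (Pop i) = {Pop i, Skip}"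
| "derivs \<Gamma> (c ;; d) = (\<lambda>c'. c' ;; d) ` derivs \<Gamma> c \<union> derivs \<Gamma> d"
| "derivs \<Gamma> (Branch i g) = insert (Branch i g) (\<Union>a\<in>\<Gamma>. derivs \<Gamma> (g a))"
| "derivs \<Gamma> (While i P c) = {While i P c, Skip} \<union> (\<lambda>c'. c' ;; While i P c) ` derivs \<Gamma> c"

lemma finite_derivs: "finite \<Gamma> \<Longrightarrow> finite (derivs \<Gamma> c)"
  by (induction c) auto

lemma self_in_derivs: "c \<in> derivs \<Gamma> c"
  by (induction c) auto

lemma wf_com_derivs: "wf_com k \<Gamma> c \<Longrightarrow> derivs \<Gamma> c \<subseteq> {c'. wf_com k \<Gamma> c'}"
proof (induction c)
  case (Seq c d)
  then have "derivs \<Gamma> c \<subseteq> {c'. wf_com k \<Gamma> c'}" "derivs \<Gamma> d \<subseteq> {c'. wf_com k \<Gamma> c'}" by simp_all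
  with Seq.prems show ?case by auto
next
  case (Branch i g)
  then have "derivs \<Gamma> (g a) \<subseteq> {c'. wf_com k \<Gamma> c'}" if "a \<in> \<Gamma>" for a using that by simp
  with Branch.prems show ?case by auto
next
  case (While i P c)
  then have "derivs \<Gamma> c \<subseteq> {c'. wf_com k \<Gamma> c'}" by simp
  with While.prems show ?case by auto
qed simp_all

primrec wf_op :: "nat \<Rightarrow> 'a tsym set \<Rightarrow> 'a stack_op \<Rightarrow> bool" where
  "wf_op k \<Gamma> Nop \<longleftrightarrow> True"
| "wf_op k \<Gamma> (PushBlank i) \<longleftrightarrow> i < k"
| "wf_op k \<Gamma> (SetTop i a) \<longleftrightarrow> i < k \<and> a \<in> \<Gamma>"
| "wf_op k \<Gamma> (Drop i) \<longleftrightarrow> i < k"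

lemma wf_op_next: "wf_com k \<Gamma> c \<Longrightarrow> wf_op k \<Gamma> (snd (next_op c r))"
  by (induction c) auto

lemma next_op_derivs:
  "wf_com k \<Gamma> c \<Longrightarrow> c' \<in> derivs \<Gamma> c \<Longrightarrow> \<forall>i<k. r i \<in> \<Gamma> \<Longrightarrow> fst (next_op c' r) \<in> derivs \<Gamma> c"
proof (induction c arbitrary: c')
  case (Seq c d)
  then show ?case using self_in_derivs[of d \<Gamma>] by auto
next
  case (Branch i g)
  show ?case
  proof (cases "c' = Branch i g")
    case True
    then show ?thesis using Branch.prems self_in_derivs[of "g (r i)" \<Gamma>] by auto
  next
    case False
    then obtain a where "a \<in> \<Gamma>" "c' \<in> derivs \<Gamma> (g a)" using Branch.prems(2) by auto
    then show ?thesis using Branch.IH[of "g a" c'] Branch.prems(1,3) by auto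
  qed
next
  case (While i P c)
  consider "c' = While i P c" | "c' = Skip" | c1 where "c1 \<in> derivs \<Gamma> c" "c' = c1 ;; While i P c"
    using While.prems(2) by auto
  then show ?case
  proof cases
    case 3
    then have "fst (next_op c1 r) \<in> derivs \<Gamma> c" using While by simp
    then show ?thesis using 3 by simp
  qed (use self_in_derivs[of c \<Gamma>] in simp_all)
qed auto

text \<open>A stack lives on the cells from the head position rightwards; everything to the left of
  the head is blank, so a step to the left pushes a blank. The input is then initially a stack
  with its first letter on top.\<close>

definition represents :: "'a tape \<Rightarrow> 'a tsym list \<Rightarrow> bool" where
  "represents t xs \<longleftrightarrow>
     (\<forall>j. fst t (snd t + j) = (if 0 \<le> j \<and> j < int (length xs) then xs ! nat j else Blank))"

lemma read_represents: "represents t xs \<Longrightarrow> read_tape t = stack_top xs"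
  unfolding represents_def read_tape_def
  by (drule spec[of _ 0]) (cases xs, auto)

lemma represents_cell:
  "represents t xs \<Longrightarrow>
   fst t j = (if 0 \<le> j - snd t \<and> j - snd t < int (length xs) then xs ! nat (j - snd t) else Blank)"
  unfolding represents_def by (drule spec[of _ "j - snd t"]) simp

lemma act_tape_keep: "act_tape t (read_tape t, 0) = t"
  by (simp add: act_tape_def read_tape_def)

lemma represents_push:
  assumes "represents t xs"
  shows "represents (act_tape t (read_tape t, -1)) (Blank # xs)"
  using represents_cell[OF assms]
  by (auto simp: represents_def act_tape_def read_tape_def nth_Cons' nat_diff_distrib)

lemma represents_set:
  assumes "represents t xs"
  shows "represents (act_tape t (a, 0)) (a # tl xs)"
  using represents_cell[OF assms]
  by (cases xs) (auto simp: represents_def act_tape_def nth_Cons')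

lemma represents_drop:
  assumes "represents t xs"
  shows "represents (act_tape t (Blank, 1)) (tl xs)"
  using represents_cell[OF assms]
  by (cases xs) (auto simp: represents_def act_tape_def nth_Cons' nat_add_distrib)

primrec tape_acts :: "'a tsym list \<Rightarrow> 'a stack_op \<Rightarrow> ('a tsym \<times> int) list" where
  "tape_acts rs Nop = map (\<lambda>a. (a, 0)) rs"
| "tape_acts rs (PushBlank i) = (map (\<lambda>a. (a, 0)) rs)[i := (rs ! i, -1)]"
| "tape_acts rs (SetTop i a) = (map (\<lambda>a. (a, 0)) rs)[i := (a, 0)]"
| "tape_acts rs (Drop i) = (map (\<lambda>a. (a, 0)) rs)[i := (Blank, 1)]"

lemma length_tape_acts [simp]: "length (tape_acts rs a) = length rs"
  by (cases a) auto

lemma set_tape_acts: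
  "wf_op (length rs) \<Gamma> a \<Longrightarrow> Blank \<in> \<Gamma> \<Longrightarrow> set rs \<subseteq> \<Gamma> \<Longrightarrow> set (tape_acts rs a) \<subseteq> \<Gamma> \<times> {-1, 0, 1}"
  by (cases a) (auto dest!: subsetD[OF set_update_subset_insert])

lemma represents_acts:
  assumes "length ts = k" "\<forall>i<k. represents (ts ! i) (s i)" "wf_op k \<Gamma> a" "i < k"
  shows "represents (map2 act_tape ts (tape_acts (map read_tape ts) a) ! i) (apply_op a s i)"
  using assms
  by (cases a) (auto simp: nth_list_update act_tape_keep represents_push represents_set
      represents_drop)

lemma set_tl_subset: "set (tl xs) \<subseteq> set xs"
  by (cases xs) auto

text \<open>Step-by-step simulation, so \<open>p\<close> itself bounds the machine.
  \<open>code\<close> merely names the residual programs by natural numbers, the state type that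
  \<open>poly_time_decidable\<close> asks for.\<close>

lemma poly_time_decidableI:
  fixes prog :: "'a com" and p :: "nat poly"
  assumes fin: "finite \<Sigma>" "finite \<Gamma>" and \<Gamma>: "Blank \<in> \<Gamma>" "Inp ` \<Sigma> \<subseteq> \<Gamma>" and k: "k \<ge> 1"
    and L: "L \<subseteq> lists \<Sigma>" and wf: "wf_com k \<Gamma> prog"
    and run: "\<And>w. w \<in> lists \<Sigma> \<Longrightarrow>
      \<exists>s'. reaches prog ((\<lambda>_. [])(0 := map Inp w)) (poly p (length w)) (Halt (w \<in> L)) s'"
  shows "poly_time_decidable \<Sigma> L"
proof -
  \<comment> \<open>The program may never produce one of the two \<open>Halt\<close> commands, yet
    the machine must have both an accepting and a rejecting state.\<close>
  define Q where "Q = derivs \<Gamma> prog \<union> {Halt True, Halt False}"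
  have "finite Q" by (simp add: Q_def finite_derivs fin)
  then obtain code :: "'a com \<Rightarrow> nat" where inj: "inj_on code Q"
    using finite_imp_inj_to_nat_seg by metis
  define dec where "dec = inv_into Q code"
  have dec: "dec (code c) = c" if "c \<in> Q" for c
    using that inj by (simp add: dec_def)
  define M :: "(nat, 'a) tm" where
    "M = \<lparr>tape_count = k, tm_states = code ` Q, tm_alphabet = \<Gamma>, start_state = code prog,
      accept_state = code (Halt True), reject_state = code (Halt False),
      transition = (\<lambda>q rs. case next_op (dec q) (\<lambda>i. rs ! i) of
        (c', a) \<Rightarrow> (code c', tape_acts rs a))\<rparr>"
  have wfQ: "wf_com k \<Gamma> c" if "c \<in> Q" for c
    using that wf_com_derivs[OF wf] by (auto simp: Q_def)
  have nextQ: "fst (next_op c r) \<in> Q" if "c \<in> Q" "\<forall>i<k. r i \<in> \<Gamma>" for c r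
    using that next_op_derivs[OF wf] by (auto simp: Q_def)
  \<comment> \<open>\<open>rs ! i\<close> is unspecified beyond the \<open>k\<close> tapes; a
    well-formed program does not look there.\<close>
  have next_cong: "next_op c r = next_op c r'"
    if "wf_com k \<Gamma> c" "\<forall>i<k. r i = r' i" for c r r'
    using that by (induction c) auto
  have is_tm: "is_tm \<Sigma> M"
  proof -
    have "code (Halt True) \<noteq> code (Halt False)"
      using inj_onD[OF inj, of "Halt True" "Halt False"] by (auto simp: Q_def)
    moreover have "case transition M q rs of (q', acts) \<Rightarrow>
        q' \<in> tm_states M \<and> length acts = tape_count M \<and> set acts \<subseteq> tm_alphabet M \<times> {-1, 0, 1}"
      if q: "q \<in> tm_states M" and "rs \<in> lists (tm_alphabet M)" "length rs = tape_count M" for q rs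
    proof -
      obtain c where c: "c \<in> Q" "q = code c" using q by (auto simp: M_def)
      obtain c' a where ca: "next_op c (\<lambda>i. rs ! i) = (c', a)" by fastforce
      have len: "length rs = k" and rs: "set rs \<subseteq> \<Gamma>" using that by (auto simp: M_def)
      have "wf_op k \<Gamma> a" using wf_op_next[OF wfQ[OF c(1)], of "\<lambda>i. rs ! i"] ca by simp
      then have "set (tape_acts rs a) \<subseteq> \<Gamma> \<times> {-1, 0, 1}"
        using set_tape_acts \<Gamma>(1) rs len by metis
      moreover have "\<forall>i<k. rs ! i \<in> \<Gamma>" using rs len by (auto simp: subset_iff)
      then have "c' \<in> Q" using nextQ[OF c(1), of "\<lambda>i. rs ! i"] ca by simp
      ultimately show ?thesis
        using dec[OF c(1)] c(2) ca len by (simp add: M_def)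
    qed
    ultimately show ?thesis
      unfolding is_tm_def using k fin \<Gamma> \<open>finite Q\<close> self_in_derivs[of prog \<Gamma>]
      by (auto simp: M_def Q_def)
  qed
  have sim: "\<exists>ts. (tm_step M ^^ t) (tm_init M w) = (code c, ts) \<and> c \<in> Q \<and> length ts = k \<and>
      (\<forall>i<k. set (s i) \<subseteq> \<Gamma> \<and> represents (ts ! i) (s i))"
    if w: "w \<in> lists \<Sigma>" and cs: "(com_step ^^ t) (prog, (\<lambda>_. [])(0 := map Inp w)) = (c, s)" for w t c s
    using cs
  proof (induction t arbitrary: c s)
    case 0
    have "set (map Inp w) \<subseteq> \<Gamma>" using w \<Gamma> by auto
    moreover have "represents (snd (tm_init M w) ! i) (((\<lambda>_. [])(0 := map Inp w)) i)" if "i < k" for i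
      using that by (cases i) (auto simp: tm_init_def M_def represents_def)
    ultimately show ?case
      using 0 k self_in_derivs[of prog \<Gamma>] by (auto simp: tm_init_def M_def Q_def)
  next
    case (Suc t)
    obtain c1 s1 where cs1: "(com_step ^^ t) (prog, (\<lambda>_. [])(0 := map Inp w)) = (c1, s1)"
      by fastforce
    from Suc.IH[OF this] obtain ts where
      ts: "(tm_step M ^^ t) (tm_init M w) = (code c1, ts)" and c1: "c1 \<in> Q" and len: "length ts = k"
      and s1: "\<And>i. i < k \<Longrightarrow> set (s1 i) \<subseteq> \<Gamma>" and rep: "\<forall>i<k. represents (ts ! i) (s1 i)"
      by blast
    have step: "com_step (c1, s1) = (c, s)" using Suc.prems by (simp only: funpow.simps comp_apply cs1)
    have topG: "\<forall>i<k. stack_top (s1 i) \<in> \<Gamma>"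
    proof (intro allI impI)
      fix i assume "i < k"
      from s1[OF this] show "stack_top (s1 i) \<in> \<Gamma>" using \<Gamma> by (cases "s1 i") auto
    qed
    obtain a where ca: "next_op c1 (\<lambda>i. stack_top (s1 i)) = (c, a)" and s: "s = apply_op a s1"
      using step by (auto simp: com_step_def split: prod.splits)
    have cQ: "c \<in> Q" using nextQ[OF c1 topG] ca by simp
    have wfa: "wf_op k \<Gamma> a" using wf_op_next[OF wfQ[OF c1], of "\<lambda>i. stack_top (s1 i)"] ca by simp
    have s\<Gamma>: "set (s i) \<subseteq> \<Gamma>" if "i < k" for i
      using wfa s1[OF that] \<Gamma>(1) set_tl_subset[of "s1 i"] by (cases a) (auto simp: s)
    show ?case
    proof (cases "code c1 \<in> {accept_state M, reject_state M}")
      \<comment> \<open>In a final state the machine freezes. So does the program: by injectivity of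
        \<open>code\<close> it is a \<open>Halt\<close>, which leaves itself and the stacks
        unchanged.\<close>
      case True
      then have "c1 = Halt True \<or> c1 = Halt False"
        using inj_onD[OF inj _ c1, of "Halt True"] inj_onD[OF inj _ c1, of "Halt False"]
        by (auto simp: M_def Q_def)
      then have "c = c1" "s = s1" using ca s by auto
      moreover have "tm_step M (code c1, ts) = (code c1, ts)" using True by (simp add: tm_step_def)
      ultimately show ?thesis using ts c1 len s1 rep by auto
    next
      case False
      have "next_op c1 (\<lambda>i. map read_tape ts ! i) = (c, a)"
        using next_cong[OF wfQ[OF c1], of "\<lambda>i. map read_tape ts ! i" "\<lambda>i. stack_top (s1 i)"] ca len rep
        by (simp add: read_represents)
      then have "tm_step M (code c1, ts) = (code c, map2 act_tape ts (tape_acts (map read_tape ts) a))"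
        using False dec[OF c1] by (simp add: tm_step_def M_def)
      then show ?thesis
        using ts cQ len s\<Gamma> represents_acts[OF len rep wfa] by (auto simp: s)
    qed
  qed
  have "decides_in_time M \<Sigma> L (poly p)"
    unfolding decides_in_time_def
  proof
    fix w assume w: "w \<in> lists \<Sigma>"
    from run[OF this] obtain s' t where
      t: "t \<le> poly p (length w)" "(com_step ^^ t) (prog, (\<lambda>_. [])(0 := map Inp w)) = (Halt (w \<in> L), s')"
      unfolding reaches_def by blast
    from sim[OF w t(2)] have "fst ((tm_step M ^^ t) (tm_init M w)) = code (Halt (w \<in> L))"
      by auto
    then show "\<exists>t\<le>poly p (length w). fst ((tm_step M ^^ t) (tm_init M w)) =
        (if w \<in> L then accept_state M else reject_state M)"
      using t(1) by (auto simp: M_def)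
  qed
  then show ?thesis
    unfolding poly_time_decidable_def using fin L is_tm by blast
qed

section \<open>Moving and deleting blocks of symbols\<close>

definition move_while :: "nat \<Rightarrow> ('a tsym \<Rightarrow> bool) \<Rightarrow> nat \<Rightarrow> 'a com" where
  "move_while i P j = While i P (Branch i (\<lambda>a. Pop i ;; Push j a))"

definition drop_while :: "nat \<Rightarrow> ('a tsym \<Rightarrow> bool) \<Rightarrow> 'a com" where
  "drop_while i P = While i P (Pop i)"

abbreviation nonblank :: "'a tsym \<Rightarrow> bool" where
  "nonblank a \<equiv> a \<noteq> Blank"

abbreviation move_all :: "nat \<Rightarrow> nat \<Rightarrow> 'a com" where
  "move_all i j \<equiv> move_while i nonblank j"

abbreviation clear :: "nat \<Rightarrow> 'a com" where
  "clear i \<equiv> drop_while i nonblank"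

text \<open>Seven steps per symbol: two for the loop, one for the branch, which keeps the symbol in
  the control state, and four for \<open>Pop ;; Push\<close>. \<open>\<not> P Blank\<close> stops
  the loop on an empty stack.\<close>

lemma reaches_move_while:
  assumes "i \<noteq> j" "\<not> P Blank"
  shows "reaches (move_while i P j) s (7 * length (takeWhile P (s i)) + 1) Skip
    (s(i := dropWhile P (s i), j := rev (takeWhile P (s i)) @ s j))"
proof (induction "s i" arbitrary: s)
  case Nil
  have "\<not> P (stack_top (s i))" using assms Nil by (simp flip: Nil)
  from reaches_While_False[of P s i, OF this] show ?case
    unfolding move_while_def
    by (rule reaches_weaken) (auto simp: Nil[symmetric])
next
  case (Cons a xs)
  show ?case
  proof (cases "P a")
    case True
    let ?s = "s(i := xs, j := a # s j)"
    have rest: "reaches (move_while i P j) ?s (7 * length (takeWhile P (?s i)) + 1) Skip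
        (?s(i := dropWhile P (?s i), j := rev (takeWhile P (?s i)) @ ?s j))"
      by (rule Cons.hyps(1)) (use assms in simp)
    have body: "reaches (Branch i (\<lambda>a. Pop i ;; Push j a)) s 5 Skip ?s"
      by (rule reaches_weaken[OF reaches_Branch[OF reaches_Seq[OF reaches_Pop reaches_Push]]])
         (use assms in \<open>auto simp: fun_eq_iff simp flip: Cons.hyps(2)\<close>)
    show ?thesis
      unfolding move_while_def
      by (rule reaches_weaken[OF reaches_While_True[OF _ body rest[unfolded move_while_def]]])
         (use True assms in \<open>auto simp: fun_eq_iff simp flip: Cons.hyps(2)\<close>)
  next
    case False
    then have "\<not> P (stack_top (s i))" by (simp flip: Cons.hyps(2))
    from reaches_While_False[of P s i, OF this] show ?thesis
      unfolding move_while_def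
      by (rule reaches_weaken) (use False in \<open>auto simp: Cons.hyps(2)[symmetric]\<close>)
  qed
qed

lemma reaches_drop_while:
  assumes "\<not> P Blank"
  shows "reaches (drop_while i P) s (3 * length (takeWhile P (s i)) + 1) Skip
    (s(i := dropWhile P (s i)))"
proof (induction "s i" arbitrary: s)
  case Nil
  have "\<not> P (stack_top (s i))" using assms Nil by (simp flip: Nil)
  from reaches_While_False[of P s i, OF this] show ?case
    unfolding drop_while_def
    by (rule reaches_weaken) (auto simp: Nil[symmetric])
next
  case (Cons a xs)
  show ?case
  proof (cases "P a")
    case True
    let ?s = "s(i := xs)"
    have rest: "reaches (drop_while i P) ?s (3 * length (takeWhile P (?s i)) + 1) Skip
        (?s(i := dropWhile P (?s i)))"
      by (rule Cons.hyps(1)) simp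
    have body: "reaches (Pop i) s 1 Skip ?s"
      by (rule reaches_weaken[OF reaches_Pop]) (simp_all flip: Cons.hyps(2))
    show ?thesis
      unfolding drop_while_def
      by (rule reaches_weaken[OF reaches_While_True[OF _ body rest[unfolded drop_while_def]]])
         (use True assms in \<open>auto simp: fun_eq_iff simp flip: Cons.hyps(2)\<close>)
  next
    case False
    then have "\<not> P (stack_top (s i))" by (simp flip: Cons.hyps(2))
    from reaches_While_False[of P s i, OF this] show ?thesis
      unfolding drop_while_def
      by (rule reaches_weaken) (use False in \<open>auto simp: Cons.hyps(2)[symmetric]\<close>)
  qed
qed

lemma takeWhile_nonblank: "Blank \<notin> set xs \<Longrightarrow> takeWhile nonblank xs = xs"
  by (induction xs) auto

lemma dropWhile_nonblank: "Blank \<notin> set xs \<Longrightarrow> dropWhile nonblank xs = []"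
  by (induction xs) auto

lemma reaches_move_all:
  assumes "i \<noteq> j" "Blank \<notin> set (s i)"
  shows "reaches (move_all i j) s (7 * length (s i) + 1) Skip
    (s(i := [], j := rev (s i) @ s j))"
  using reaches_move_while[OF assms(1), of nonblank s] assms(2)
  by (simp add: takeWhile_nonblank dropWhile_nonblank)

lemma reaches_clear:
  assumes "Blank \<notin> set (s i)"
  shows "reaches (clear i) s (3 * length (s i) + 1) Skip (s(i := []))"
  using reaches_drop_while[of nonblank i s] assms
  by (simp add: takeWhile_nonblank dropWhile_nonblank)

primrec push_all :: "nat \<Rightarrow> 'a tsym list \<Rightarrow> 'a com" where
  "push_all i [] = Skip"
| "push_all i (x # xs) = push_all i xs ;; Push i x"

lemma reaches_push_all:
  "reaches (push_all i xs) s (3 * length xs) Skip (s(i := xs @ s i))"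
proof (induction xs)
  case Nil
  then show ?case using reaches_refl[of Skip s] by simp
next
  case (Cons x xs)
  show ?case
    by (simp only: push_all.simps, rule reaches_weaken[OF reaches_Seq[OF Cons reaches_Push]]) auto
qed

section \<open>Cancelling atoms\<close>

text \<open>While \<open>KEY\<close> is compared with the entries on \<open>ATOMS\<close>, the stack \<open>SEEN\<close> collects the entries
  passed, in reverse, \<open>TMP\<close> the matched part of the key, \<open>DIFF\<close> a flag for each mismatch and
  \<open>FOUND\<close> a flag for each entry removed. \<open>PAR\<close> is nonempty iff the constant is 1, and \<open>ERR\<close>
  becomes nonempty at a syntax error; input that ends too early leaves \<open>TASK\<close> nonempty instead.\<close>

abbreviation (input) "IN \<equiv> 0 :: nat"
abbreviation (input) "TASK \<equiv> 1 :: nat"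
abbreviation (input) "DEPTH \<equiv> 2 :: nat"
abbreviation (input) "TMP \<equiv> 3 :: nat"
abbreviation (input) "KEY \<equiv> 4 :: nat"
abbreviation (input) "ATOMS \<equiv> 5 :: nat"
abbreviation (input) "SEEN \<equiv> 6 :: nat"
abbreviation (input) "DIFF \<equiv> 7 :: nat"
abbreviation (input) "FOUND \<equiv> 8 :: nat"
abbreviation (input) "PAR \<equiv> 9 :: nat"
abbreviation (input) "ERR \<equiv> 10 :: nat"

text \<open>\<open>Aux 0\<close> and \<open>Aux 1\<close> are left for the tasks
  \<open>Some False\<close> and \<open>Some True\<close>; \<open>Undo\<close> is the task
  \<open>None\<close> and takes one \<open>Mark\<close> off \<open>DEPTH\<close>.\<close>

abbreviation (input) "Undo \<equiv> Aux 2"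
abbreviation (input) "Mark \<equiv> Aux 3"
abbreviation (input) "Sep \<equiv> Aux 4"
abbreviation (input) "Flag \<equiv> Aux 5"

definition mk_stacks ::
  "'a tsym list \<Rightarrow> 'a tsym list \<Rightarrow> 'a tsym list \<Rightarrow> 'a tsym list \<Rightarrow> 'a tsym list \<Rightarrow> 'a tsym list \<Rightarrow>
   'a tsym list \<Rightarrow> 'a tsym list \<Rightarrow> 'a tsym list \<Rightarrow> 'a tsym list \<Rightarrow> 'a tsym list \<Rightarrow> 'a stacks" where
  "mk_stacks w ts d m k l r f g c e =
     (\<lambda>_. [])(IN := w, TASK := ts, DEPTH := d, TMP := m, KEY := k, ATOMS := l, SEEN := r,
       DIFF := f, FOUND := g, PAR := c, ERR := e)"

lemma mk_stacks_nth [simp]: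
  "mk_stacks w ts d m k l r f g c e IN = w"
  "mk_stacks w ts d m k l r f g c e (Suc 0) = ts"
  "mk_stacks w ts d m k l r f g c e DEPTH = d"
  "mk_stacks w ts d m k l r f g c e TMP = m"
  "mk_stacks w ts d m k l r f g c e KEY = k"
  "mk_stacks w ts d m k l r f g c e ATOMS = l"
  "mk_stacks w ts d m k l r f g c e SEEN = r"
  "mk_stacks w ts d m k l r f g c e DIFF = f"
  "mk_stacks w ts d m k l r f g c e FOUND = g"
  "mk_stacks w ts d m k l r f g c e PAR = c"
  "mk_stacks w ts d m k l r f g c e ERR = e"
  by (simp_all add: mk_stacks_def)

lemma mk_stacks_upd [simp]:
  "(mk_stacks w ts d m k l r f g c e)(IN := x) = mk_stacks x ts d m k l r f g c e"
  "(mk_stacks w ts d m k l r f g c e)(Suc 0 := x) = mk_stacks w x d m k l r f g c e"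
  "(mk_stacks w ts d m k l r f g c e)(DEPTH := x) = mk_stacks w ts x m k l r f g c e"
  "(mk_stacks w ts d m k l r f g c e)(TMP := x) = mk_stacks w ts d x k l r f g c e"
  "(mk_stacks w ts d m k l r f g c e)(KEY := x) = mk_stacks w ts d m x l r f g c e"
  "(mk_stacks w ts d m k l r f g c e)(ATOMS := x) = mk_stacks w ts d m k x r f g c e"
  "(mk_stacks w ts d m k l r f g c e)(SEEN := x) = mk_stacks w ts d m k l x f g c e"
  "(mk_stacks w ts d m k l r f g c e)(DIFF := x) = mk_stacks w ts d m k l r x g c e"
  "(mk_stacks w ts d m k l r f g c e)(FOUND := x) = mk_stacks w ts d m k l r f x c e"
  "(mk_stacks w ts d m k l r f g c e)(PAR := x) = mk_stacks w ts d m k l r f g x e"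
  "(mk_stacks w ts d m k l r f g c e)(ERR := x) = mk_stacks w ts d m k l r f g c x"
  by (simp_all add: mk_stacks_def fun_eq_iff)

definition in_entry :: "'a tsym \<Rightarrow> bool" where
  "in_entry a \<longleftrightarrow> a \<noteq> Sep \<and> a \<noteq> Blank"

lemma in_entry_simps [simp]: "\<not> in_entry Blank" "\<not> in_entry Sep" "in_entry a \<Longrightarrow> a \<noteq> Blank"
  by (auto simp: in_entry_def)

text \<open>After a mismatch the loop runs on, because the entry has to reach \<open>SEEN\<close> in
  full. Later letters may still consume letters of the key; \<open>TMP\<close> keeps them.\<close>

definition compare :: "'a com" where
  "compare = While ATOMS in_entry (Branch ATOMS (\<lambda>a. Pop ATOMS ;; Push SEEN a ;;
     Branch KEY (\<lambda>b. if b = a then Pop KEY ;; Push TMP b else Push DIFF Flag)))"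

text \<open>No flag means that each letter matched the next one of the key, and an empty
  \<open>KEY\<close> that nothing was left over; together this is equality. A key that runs out
  early shows \<open>Blank\<close>, which differs from every entry letter and so yields a flag. The
  equation for \<open>rev m' @ k'\<close> allows the key to be rebuilt.\<close>

lemma reaches_compare:
  assumes "\<forall>a\<in>set x. in_entry a"
  shows "\<exists>m' k' f'. reaches compare (mk_stacks w ts d m k (x @ Sep # l) r f g c e)
      (13 * length x + 1) Skip (mk_stacks w ts d m' k' (Sep # l) (rev x @ r) f' g c e) \<and>
    rev m' @ k' = rev m @ k \<and> (k' = [] \<and> f' = [] \<longleftrightarrow> x = k \<and> f = []) \<and>
    length m' \<le> length m + length x \<and> length f' \<le> length f + length x \<and>
    set f' \<subseteq> insert Flag (set f)"
  using assms
proof (induction x arbitrary: m k r f)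
  case Nil
  show ?case unfolding compare_def
    by (intro exI conjI, rule reaches_weaken, rule reaches_While_False) auto
next
  case (Cons a x)
  let ?body = "Branch ATOMS (\<lambda>a. Pop ATOMS ;; Push SEEN a ;;
     Branch KEY (\<lambda>b. if b = a then Pop KEY ;; Push TMP b else Push DIFF Flag))"
  let ?m = "if stack_top k = a then a # m else m" and ?k = "if stack_top k = a then tl k else k"
  let ?f = "if stack_top k = a then f else Flag # f"
  have a: "in_entry a" using Cons.prems by simp
  have k: "k \<noteq> []" "hd k = a" if "stack_top k = a"
    using a that by (cases k; auto)+
  have body: "reaches ?body (mk_stacks w ts d m k ((a # x) @ Sep # l) r f g c e) 11 Skip
      (mk_stacks w ts d ?m ?k (x @ Sep # l) (a # r) ?f g c e)"
  proof (cases "stack_top k = a")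
    case True
    show ?thesis
      apply (rule reaches_weaken[OF reaches_Branch[OF
            reaches_Seq[OF reaches_Pop reaches_Seq[OF reaches_Push reaches_Branch]]]])
        apply (simp add: True)
        apply (rule reaches_Seq[OF reaches_Pop reaches_Push])
      using True by simp_all
  next
    case False
    show ?thesis
      apply (rule reaches_weaken[OF reaches_Branch[OF
            reaches_Seq[OF reaches_Pop reaches_Seq[OF reaches_Push reaches_Branch]]]])
        apply (simp add: False)
        apply (rule reaches_Push)
      using False by simp_all
  qed
  from Cons.IH[of ?m ?k "a # r" ?f] Cons.prems obtain m' k' f' where
    run: "reaches compare (mk_stacks w ts d ?m ?k (x @ Sep # l) (a # r) ?f g c e)
      (13 * length x + 1) Skip (mk_stacks w ts d m' k' (Sep # l) (rev x @ a # r) f' g c e)"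
    and IH: "rev m' @ k' = rev ?m @ ?k" "k' = [] \<and> f' = [] \<longleftrightarrow> x = ?k \<and> ?f = []"
      "length m' \<le> length ?m + length x" "length f' \<le> length ?f + length x"
      "set f' \<subseteq> insert Flag (set ?f)"
    by auto
  have "reaches compare (mk_stacks w ts d m k ((a # x) @ Sep # l) r f g c e)
      (13 * length (a # x) + 1) Skip (mk_stacks w ts d m' k' (Sep # l) (rev (a # x) @ r) f' g c e)"
    unfolding compare_def
    by (rule reaches_weaken[OF reaches_While_True[OF _ body run[unfolded compare_def]]])
       (use a in auto)
  moreover have "rev m' @ k' = rev m @ k" using IH(1) k by (cases k) auto
  moreover have "k' = [] \<and> f' = [] \<longleftrightarrow> a # x = k \<and> f = []"
    using IH(2) k by (cases k) auto
  moreover have "length m' \<le> length m + length (a # x)" using IH(3) by (auto split: if_splits)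
  moreover have "length f' \<le> length f + length (a # x)" using IH(4) by (auto split: if_splits)
  moreover have "set f' \<subseteq> insert Flag (set f)" using IH(5) by (auto split: if_splits)
  ultimately show ?case by blast
qed

definition scan_entry :: "'a com" where
  "scan_entry = compare ;;
     Branch KEY (\<lambda>b. Branch DIFF (\<lambda>f.
       if b = Blank \<and> f = Blank then Pop ATOMS ;; drop_while SEEN in_entry ;; Push FOUND Flag
       else Pop ATOMS ;; Push SEEN Sep)) ;;
     clear DIFF ;; move_all TMP KEY"

lemma takeWhile_entry:
  "\<forall>a\<in>set x. in_entry a \<Longrightarrow> \<not> in_entry (stack_top r) \<Longrightarrow> takeWhile in_entry (rev x @ r) = rev x"
  by (cases r) (auto simp: takeWhile_append)

lemma dropWhile_entry:
  "\<forall>a\<in>set x. in_entry a \<Longrightarrow> \<not> in_entry (stack_top r) \<Longrightarrow> dropWhile in_entry (rev x @ r) = r"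
  by (cases r) (auto simp: dropWhile_append)

text \<open>The condition on \<open>r\<close> says that \<open>SEEN\<close> is empty or shows
  \<open>Sep\<close>, so deleting the copy of a matching entry stops exactly at its boundary. 26 =
  13 + 3 + 3 + 7: comparing, deleting the copy, clearing the flags, restoring the key.\<close>

lemma reaches_scan_entry:
  assumes x: "\<forall>a\<in>set x. in_entry a" and k: "Blank \<notin> set k" and r: "\<not> in_entry (stack_top r)"
  shows "reaches scan_entry (mk_stacks w ts d [] k (x @ Sep # l) r [] g c e)
      (26 * length x + 20) Skip
      (mk_stacks w ts d [] k l (if x = k then r else Sep # rev x @ r) []
        (if x = k then Flag # g else g) c e)"
proof -
  obtain m' k' f' where
    cmp: "reaches compare (mk_stacks w ts d [] k (x @ Sep # l) r [] g c e)
      (13 * length x + 1) Skip (mk_stacks w ts d m' k' (Sep # l) (rev x @ r) f' g c e)"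
    and *: "rev m' @ k' = k" "k' = [] \<and> f' = [] \<longleftrightarrow> x = k"
      "length m' \<le> length x" "length f' \<le> length x" "set f' \<subseteq> {Flag}"
    using reaches_compare[OF x, of w ts d "[]" k l r "[]" g c e] by auto
  have bl: "Blank \<notin> set f'" "Blank \<notin> set m'" "Blank \<notin> set k'" using * k by auto
  have top_Blank: "stack_top ys = Blank \<longleftrightarrow> ys = []" if "Blank \<notin> set ys" for ys :: "'a tsym list"
    using that by (cases ys) auto
  let ?g = "if x = k then Flag # g else g"
  let ?r = "if x = k then r else Sep # rev x @ r"
  have br: "reaches (Branch KEY (\<lambda>b. Branch DIFF (\<lambda>f.
       if b = Blank \<and> f = Blank then Pop ATOMS ;; drop_while SEEN in_entry ;; Push FOUND Flag
       else Pop ATOMS ;; Push SEEN Sep))) (mk_stacks w ts d m' k' (Sep # l) (rev x @ r) f' g c e)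
     (3 * length x + 8) Skip (mk_stacks w ts d m' k' l ?r f' ?g c e)"
  proof (cases "x = k")
    case True
    then have "k' = []" "f' = []" using * by auto
    with True show ?thesis
      apply -
      apply (rule reaches_weaken, rule reaches_Branch, rule reaches_Branch)
        apply simp
        apply (rule reaches_Seq[OF reaches_Pop reaches_Seq[OF reaches_drop_while reaches_Push]])
      using x r by (simp_all add: takeWhile_entry dropWhile_entry)
  next
    case False
    then have ne: "(stack_top k' = Blank \<and> stack_top f' = Blank) = False"
      using * bl by (simp add: top_Blank)
    show ?thesis
      apply (rule reaches_weaken, rule reaches_Branch, rule reaches_Branch)
        apply (simp only: mk_stacks_nth ne if_False)
        apply (rule reaches_Seq[OF reaches_Pop reaches_Push])
      using False by simp_all
  qed
  show ?thesis
    unfolding scan_entry_def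
    by (rule reaches_weaken[OF reaches_Seq[OF cmp reaches_Seq[OF br
          reaches_Seq[OF reaches_clear reaches_move_all]]]])
       (use bl * in auto)
qed

definition entries :: "'a tsym list list \<Rightarrow> 'a tsym list" where
  "entries Ls = concat (map (\<lambda>x. x @ [Sep]) Ls)"

lemma entries_simps [simp]:
  "entries [] = []" "entries (x # Ls) = x @ Sep # entries Ls"
  by (simp_all add: entries_def)

definition scan :: "'a com" where
  "scan = While ATOMS nonblank scan_entry"

text \<open>The constant cost of an entry, 20 steps and 2 for the loop, is charged to its separator,
  which counts for 26.\<close>

lemma reaches_scan:
  assumes "\<forall>x\<in>set Ls. \<forall>a\<in>set x. in_entry a" "Blank \<notin> set k" "\<not> in_entry (stack_top r)"
  shows "reaches scan (mk_stacks w ts d [] k (entries Ls) r [] g c e)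
      (26 * length (entries Ls) + 1) Skip
      (mk_stacks w ts d [] k [] (rev (entries (filter (\<lambda>x. x \<noteq> k) Ls)) @ r) []
        (replicate (count_list Ls k) Flag @ g) c e)"
  using assms
proof (induction Ls arbitrary: r g)
  case Nil
  show ?case unfolding scan_def
    by (rule reaches_weaken, rule reaches_While_False) auto
next
  case (Cons x Ls)
  let ?r = "if x = k then r else Sep # rev x @ r" and ?g = "if x = k then Flag # g else g"
  have one: "reaches scan_entry (mk_stacks w ts d [] k (entries (x # Ls)) r [] g c e)
      (26 * length x + 20) Skip (mk_stacks w ts d [] k (entries Ls) ?r [] ?g c e)"
    using reaches_scan_entry[of x k r] Cons.prems by simp
  have rest: "reaches scan (mk_stacks w ts d [] k (entries Ls) ?r [] ?g c e)
      (26 * length (entries Ls) + 1) Skip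
      (mk_stacks w ts d [] k [] (rev (entries (filter (\<lambda>x. x \<noteq> k) Ls)) @ ?r) []
        (replicate (count_list Ls k) Flag @ ?g) c e)"
    by (rule Cons.IH) (use Cons.prems in auto)
  have "stack_top (x @ Sep # entries Ls) \<noteq> Blank" using Cons.prems by (cases x) auto
  then show ?case unfolding scan_def
    by - (rule reaches_weaken[OF reaches_While_True[OF _ one rest[unfolded scan_def]]],
        auto simp: replicate_append_same replicate_app_Cons_same)
qed

text \<open>On sets this is the symmetric difference with \<open>{x}\<close>, that is, adding an
  atom modulo 2.\<close>

definition toggle :: "'b \<Rightarrow> 'b list \<Rightarrow> 'b list" where
  "toggle x xs = (if x \<in> set xs then filter (\<lambda>y. y \<noteq> x) xs else x # xs)"

text \<open>The key travels through \<open>TMP\<close> because a single move would reverse it.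
  Moving \<open>SEEN\<close> back likewise undoes the reversal made by \<open>scan\<close>.\<close>

definition toggle_key :: "'a com" where
  "toggle_key = scan ;; move_all SEEN ATOMS ;;
     Branch FOUND (\<lambda>a. if a = Blank then Push ATOMS Sep ;; move_all KEY TMP ;; move_all TMP ATOMS
       else clear KEY ;; clear FOUND)"

lemma length_filter_entries: "length (entries (filter P Ls)) \<le> length (entries Ls)"
  by (induction Ls) auto

lemma count_le_entries: "count_list Ls k \<le> length (entries Ls)"
  by (induction Ls) auto

lemma Blank_entries: "\<forall>x\<in>set Ls. \<forall>a\<in>set x. in_entry a \<Longrightarrow> Blank \<notin> set (entries Ls)"
  by (induction Ls) auto

text \<open>36 = 26 + 7 + 3: scanning, moving back, clearing \<open>FOUND\<close>. 14 = 7 + 7: the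
  two moves of the key.\<close>

lemma reaches_toggle_key:
  assumes Ls: "\<forall>x\<in>set Ls. \<forall>a\<in>set x. in_entry a" and k: "Blank \<notin> set k"
  shows "reaches toggle_key (mk_stacks w ts d [] k (entries Ls) [] [] [] c e)
      (36 * length (entries Ls) + 14 * length k + 20) Skip
      (mk_stacks w ts d [] [] (entries (toggle k Ls)) [] [] [] c e)"
proof -
  let ?F = "entries (filter (\<lambda>x. x \<noteq> k) Ls)" and ?n = "count_list Ls k"
  note scan = reaches_scan[OF Ls k, of "[]" w ts d "[]" c e]
  have F: "Blank \<notin> set ?F" by (rule Blank_entries) (use Ls in auto)
  have last: "reaches (Branch FOUND (\<lambda>a. if a = Blank
        then Push ATOMS Sep ;; move_all KEY TMP ;; move_all TMP ATOMS
        else clear KEY ;; clear FOUND)) (mk_stacks w ts d [] k ?F [] [] (replicate ?n Flag) c e)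
      (3 * length (entries Ls) + 14 * length k + 10) Skip
      (mk_stacks w ts d [] [] (entries (toggle k Ls)) [] [] [] c e)"
  proof (cases "k \<in> set Ls")
    case True
    then obtain n' where n': "?n = Suc n'" using count_list_0_iff[of Ls k] not0_implies_Suc by auto
    show ?thesis
      apply (rule reaches_weaken[OF reaches_Branch])
        apply (simp add: n')
        apply (rule reaches_Seq[OF reaches_clear reaches_clear])
      using True k n' count_le_entries[of Ls k] by (simp_all add: toggle_def)
  next
    case False
    then have "?n = 0" "filter (\<lambda>x. x \<noteq> k) Ls = Ls" by (auto simp: filter_id_conv)
    then show ?thesis
      apply -
      apply (rule reaches_weaken[OF reaches_Branch])
        apply simp
        apply (rule reaches_Seq[OF reaches_Push reaches_Seq[OF reaches_move_all reaches_move_all]])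
      using False k by (simp_all add: toggle_def)
  qed
  show ?thesis
    unfolding toggle_key_def
    apply (rule reaches_weaken[OF reaches_Seq[OF scan reaches_Seq[OF reaches_move_all]]])
         apply simp
        apply simp
    using F apply simp
      apply simp
      apply (rule last)
    using length_filter_entries[of "\<lambda>x. x \<noteq> k" Ls] by auto
qed

section \<open>Reduction to linear forms\<close>

fun is_bit :: "symbol \<Rightarrow> bool" where
  "is_bit (BitSym b) = True"
| "is_bit _ = False"

fun bit_of :: "symbol \<Rightarrow> bool" where
  "bit_of (BitSym b) = b"
| "bit_of _ = False"

text \<open>One coefficient per argument position, since an argument occurs once in the Polish
  notation, while the index list in \<open>linear_boolfuns\<close> may repeat an index.\<close>

fun linear_form :: "bool list \<Rightarrow> bool \<Rightarrow> bool list \<Rightarrow> bool" where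
  "linear_form (e # es) c (x # xs) = ((e \<and> x) \<noteq> linear_form es c xs)"
| "linear_form _ c _ = c"

lemma linear_form_update:
  "j < length es \<Longrightarrow> length xs = length es \<Longrightarrow>
   linear_form (es[j := \<not> es ! j]) c xs = (xs ! j \<noteq> linear_form es c xs)"
proof (induction es c xs arbitrary: j rule: linear_form.induct)
  case (1 e es c x xs)
  then show ?case by (cases j) auto
qed auto

lemma linear_form_replicate_False: "linear_form (replicate n False) c xs = c"
proof (induction n arbitrary: xs)
  case (Suc n)
  then show ?case by (cases xs) auto
qed simp

text \<open>Prepending an index flips one coefficient, so repeated indices cancel in pairs.\<close>

lemma linear_boolfun_form:
  assumes "f \<in> linear_boolfuns"
  shows "\<exists>es c. length es = fst f \<and> (\<forall>xs. length xs = fst f \<longrightarrow> snd f xs = linear_form es c xs)"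
proof -
  obtain js c where js: "set js \<subseteq> {..<fst f}"
    and f: "\<And>xs. length xs = fst f \<Longrightarrow> snd f xs = foldr (\<lambda>j b. xs ! j \<noteq> b) js c"
    using assms unfolding linear_boolfuns_def by auto
  have "\<exists>es. length es = fst f \<and>
      (\<forall>xs. length xs = fst f \<longrightarrow> foldr (\<lambda>j b. xs ! j \<noteq> b) js c = linear_form es c xs)"
    using js
  proof (induction js)
    case Nil
    show ?case
      by (intro exI[of _ "replicate (fst f) False"]) (simp add: linear_form_replicate_False)
  next
    case (Cons j js)
    then obtain es where "length es = fst f"
      "\<forall>xs. length xs = fst f \<longrightarrow> foldr (\<lambda>j b. xs ! j \<noteq> b) js c = linear_form es c xs" by auto
    then show ?case
      using Cons.prems
      by (intro exI[of _ "es[j := \<not> es ! j]"]) (simp add: linear_form_update)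
  qed
  then show ?thesis using f by metis
qed

definition linear_data :: "boolfun \<Rightarrow> bool list \<times> bool" where
  "linear_data f = (SOME (es, c). length es = fst f \<and>
     (\<forall>xs. length xs = fst f \<longrightarrow> snd f xs = linear_form es c xs))"

definition coeffs_of :: "boolfun \<Rightarrow> bool list" where
  "coeffs_of f = fst (linear_data f)"

definition const_of :: "boolfun \<Rightarrow> bool" where
  "const_of f = snd (linear_data f)"

lemma linear_data:
  assumes "f \<in> linear_boolfuns"
  shows "length (coeffs_of f) = fst f"
    and "length xs = fst f \<Longrightarrow> snd f xs = linear_form (coeffs_of f) (const_of f) xs"
proof -
  have "\<exists>d. case d of (es, c) \<Rightarrow> length es = fst f \<and>
     (\<forall>xs. length xs = fst f \<longrightarrow> snd f xs = linear_form es c xs)"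
    using linear_boolfun_form[OF assms] by auto
  from someI_ex[OF this] show "length (coeffs_of f) = fst f"
    and "length xs = fst f \<Longrightarrow> snd f xs = linear_form (coeffs_of f) (const_of f) xs"
    unfolding linear_data_def[symmetric] coeffs_of_def const_of_def
    by (auto split: prod.splits)
qed

text \<open>A task \<open>Some e\<close> asks to read a formula that contributes to the value of the input iff \<open>e\<close>;
  \<open>None\<close> marks the end of the scope of an \<open>X\<close>. The list \<open>A\<close> holds the atoms
  \<open>(d, x)\<close>, standing for \<open>X\<^sup>d x\<close>, that have occurred an odd number of times.\<close>

abbreviation close_scopes :: "bool option list \<Rightarrow> bool option list" where
  "close_scopes ts \<equiv> dropWhile (\<lambda>t. t = None) ts"

abbreviation closed_depth :: "bool option list \<Rightarrow> nat \<Rightarrow> nat" where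
  "closed_depth ts d \<equiv> d - length (takeWhile (\<lambda>t. t = None) ts)"

abbreviation arg_tasks :: "bool \<Rightarrow> boolfun \<Rightarrow> bool option list" where
  "arg_tasks e f \<equiv> map (\<lambda>e'. Some (e \<and> e')) (coeffs_of f)"

text \<open>Scopes are closed whenever a formula ends, so a \<open>Some\<close> is on top when a
  symbol is read. In the connective clause this matters for arity 0: otherwise the first new task is
  a \<open>Some\<close> and nothing is closed.\<close>

function (sequential) decide ::
    "symbol list \<Rightarrow> bool option list \<Rightarrow> nat \<Rightarrow> bool \<Rightarrow> (nat \<times> var) list \<Rightarrow> bool" where
  "decide [] ts d C A \<longleftrightarrow> ts = [] \<and> (C \<or> A \<noteq> [])"
| "decide (ConnSym f # w) (Some e # ts) d C A \<longleftrightarrow>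
     decide w (close_scopes (arg_tasks e f @ ts)) (closed_depth (arg_tasks e f @ ts) d)
       (C \<noteq> (e \<and> const_of f)) A"
| "decide (NextSym # w) (Some e # ts) d C A \<longleftrightarrow> decide w (Some e # None # ts) (Suc d) C A"
| "decide (VarSym # w) (Some e # ts) d C A \<longleftrightarrow>
     decide (dropWhile is_bit w) (close_scopes ts) (closed_depth ts d) C
       (if e then toggle (d, map bit_of (takeWhile is_bit w)) A else A)"
| "decide _ _ _ _ _ \<longleftrightarrow> False"
  by pat_completeness auto
termination
  by (relation "measure (\<lambda>(w, _). length w)") (auto simp: less_Suc_eq_le length_dropWhile_le)

text \<open>\<open>decide_encode\<close> speaks only about words that encode formulae; this supplies
  the syntax check. Each \<open>Some\<close> accounts for one formula of the input, each
  \<open>None\<close> for no input.\<close>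

lemma decide_parses:
  assumes "decide w ts d C A" "w \<in> lists (symbols B)" "B \<subseteq> linear_boolfuns"
  shows "\<exists>\<phi>s. set \<phi>s \<subseteq> formulae B \<and> length \<phi>s = length (filter (\<lambda>t. t \<noteq> None) ts) \<and>
    w = concat (map encode \<phi>s)"
  using assms(1,2)
proof (induction w ts d C A rule: decide.induct)
  case (1 ts d C A)
  then show ?case by (intro exI[of _ "[]"]) auto
next
  case (2 f w e ts d C A)
  have close: "filter (\<lambda>t. t \<noteq> None) (close_scopes us) = filter (\<lambda>t. t \<noteq> None) us" for us :: "bool option list"
    by (induction us) auto
  have f: "f \<in> B" using 2 by (auto simp: symbols_def)
  then have len: "length (coeffs_of f) = fst f" using assms(3) linear_data(1) by blast
  from 2 obtain \<phi>s where \<phi>s: "set \<phi>s \<subseteq> formulae B"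
    "length \<phi>s = length (filter (\<lambda>t. t \<noteq> None) (arg_tasks e f @ ts))" "w = concat (map encode \<phi>s)"
    unfolding close by auto
  then have l: "length \<phi>s = fst f + length (filter (\<lambda>t. t \<noteq> None) ts)"
    by (simp add: len filter_map comp_def)
  \<comment> \<open>The connective opened \<open>fst f\<close> tasks, so the first
    \<open>fst f\<close> formulae are its arguments.\<close>
  let ?\<psi> = "Conn f (take (fst f) \<phi>s)"
  have "?\<psi> \<in> formulae B"
    using \<phi>s(1) f l by (intro formulae.intros) (auto dest: in_set_takeD)
  moreover have "encode ?\<psi> @ concat (map encode (drop (fst f) \<phi>s)) = ConnSym f # w"
    using \<phi>s(3) by (simp flip: concat_append map_append)
  ultimately show ?case
    using \<phi>s(1) l by (intro exI[of _ "?\<psi> # drop (fst f) \<phi>s"]) (auto dest: in_set_dropD)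
next
  case (3 w e ts d C A)
  then obtain \<phi> \<phi>s where \<phi>: "\<phi> \<in> formulae B" "set \<phi>s \<subseteq> formulae B"
    "length \<phi>s = length (filter (\<lambda>t. t \<noteq> None) ts)" "w = encode \<phi> @ concat (map encode \<phi>s)"
    by (auto simp: length_Suc_conv)
  then show ?case
    by (intro exI[of _ "Next \<phi> # \<phi>s"]) (auto intro: formulae.intros)
next
  case (4 w e ts d C A)
  have close: "filter (\<lambda>t. t \<noteq> None) (close_scopes us) = filter (\<lambda>t. t \<noteq> None) us" for us :: "bool option list"
    by (induction us) auto
  have "dropWhile is_bit w \<in> lists (symbols B)" using 4 by (auto dest: set_dropWhileD)
  with 4 obtain \<phi>s where \<phi>s: "set \<phi>s \<subseteq> formulae B"
    "length \<phi>s = length (filter (\<lambda>t. t \<noteq> None) ts)" "dropWhile is_bit w = concat (map encode \<phi>s)"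
    unfolding close by auto
  have "map BitSym (map bit_of (takeWhile is_bit w)) = takeWhile is_bit w"
    by (induction w) (auto elim: is_bit.elims)
  then have "encode (Var (map bit_of (takeWhile is_bit w))) @ concat (map encode \<phi>s) = VarSym # w"
    by (simp flip: \<phi>s(3) add: comp_def)
  then show ?case using \<phi>s(1,2)
    by (intro exI[of _ "Var (map bit_of (takeWhile is_bit w)) # \<phi>s"]) (auto intro: formulae.intros)
qed auto

text \<open>Counting over \<open>set A\<close> ignores multiplicities, in accordance with
  \<open>toggle\<close>, which deletes all copies.\<close>

definition atoms_value :: "('s, var) struct \<Rightarrow> nat \<Rightarrow> bool \<Rightarrow> (nat \<times> var) list \<Rightarrow> bool" where
  "atoms_value S i C A \<longleftrightarrow>
     (C \<noteq> odd (card {(d, x) \<in> set A. x \<in> labelling S (state_seq S (i + d))}))"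

text \<open>The symmetric difference with \<open>{(d, x)}\<close> changes the number of true atoms
  by one if this atom is true, and not at all otherwise.\<close>

lemma atoms_value_toggle:
  "atoms_value S i C (toggle (d, x) A) \<longleftrightarrow>
     (atoms_value S i C A \<noteq> (x \<in> labelling S (state_seq S (i + d))))"
proof -
  let ?P = "{(d, x). x \<in> labelling S (state_seq S (i + d))}"
  have eq: "{(d, x) \<in> set A. x \<in> labelling S (state_seq S (i + d))} = set A \<inter> ?P" for A
    by auto
  have set: "set (toggle (d, x) A) = (if (d, x) \<in> set A then set A - {(d, x)} else insert (d, x) (set A))"
    by (auto simp: toggle_def)
  show ?thesis
  proof (cases "(d, x) \<in> ?P")
    case True
    have "odd (card (set (toggle (d, x) A) \<inter> ?P)) \<longleftrightarrow> even (card (set A \<inter> ?P))"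
    proof (cases "(d, x) \<in> set A")
      case in_A: True
      then have "insert (d, x) (set (toggle (d, x) A) \<inter> ?P) = set A \<inter> ?P"
        "(d, x) \<notin> set (toggle (d, x) A) \<inter> ?P"
        using True by (auto simp: set)
      then show ?thesis using card_insert_disjoint[of "set (toggle (d, x) A) \<inter> ?P" "(d, x)"] by auto
    next
      case False
      then have "set (toggle (d, x) A) \<inter> ?P = insert (d, x) (set A \<inter> ?P)"
        using True by (auto simp: set)
      then show ?thesis using False by simp
    qed
    then show ?thesis using True unfolding atoms_value_def eq by auto
  next
    case False
    then have "set (toggle (d, x) A) \<inter> ?P = set A \<inter> ?P" by (auto simp: set)
    then show ?thesis using False unfolding atoms_value_def eq by auto
  qed
qed

text \<open>Arbitrary \<open>u\<close>, \<open>ts\<close>, \<open>C\<close> and \<open>A\<close> let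
  the claim be chained through the arguments of a connective. \<open>C'\<close> and
  \<open>A'\<close> are chosen before \<open>S\<close> and \<open>i\<close>: one linear form serves
  all structures.\<close>

lemma decide_encode:
  assumes "\<phi> \<in> formulae B" "B \<subseteq> linear_boolfuns" "no_bit u"
  shows "\<exists>C' A'. decide (encode \<phi> @ u) (Some e # ts) d C A =
      decide u (close_scopes ts) (closed_depth ts d) C' A' \<and>
    (\<forall>(S :: (nat, var) struct) i.
       atoms_value S i C' A' \<longleftrightarrow> (atoms_value S i C A \<noteq> (e \<and> models S (i + d) \<phi>)))"
  using assms(1,3)
proof (induction \<phi> arbitrary: u e ts d C A rule: fm.induct)
  case (Var x)
  have "takeWhile is_bit (map BitSym x @ u) = map BitSym x" "dropWhile is_bit (map BitSym x @ u) = u"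
    using Var.prems(2) by (cases u; cases "hd u"; auto simp: takeWhile_append dropWhile_append no_bit_def)+
  then show ?case
    by (intro exI[of _ C] exI[of _ "if e then toggle (d, x) A else A"])
       (simp add: atoms_value_toggle comp_def)
next
  case (Next \<phi>)
  have "\<phi> \<in> formulae B" using Next.prems(1) by (auto elim: formulae.cases)
  from Next.IH[OF this Next.prems(2), of e "None # ts" "Suc d" C A] show ?case by simp
next
  case (Conn f \<phi>s)
  have f: "f \<in> linear_boolfuns" and len: "length \<phi>s = fst f" and \<phi>s: "\<forall>\<phi>\<in>set \<phi>s. \<phi> \<in> formulae B"
    using Conn.prems(1) assms(2) by (auto elim!: Conn_formulaeE)
  \<comment> \<open>Inner induction on the arguments. \<open>decide\<close> adds the constant
    \<open>c\<close> before the first argument, so every suffix of the argument list is treated as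
    if \<open>c\<close> had just been added.\<close>
  have args: "\<exists>C' A'. decide (concat (map encode \<psi>s) @ u)
        (close_scopes (map (\<lambda>e'. Some (e \<and> e')) es @ ts))
        (closed_depth (map (\<lambda>e'. Some (e \<and> e')) es @ ts) d) (C \<noteq> (e \<and> c)) A =
      decide u (close_scopes ts) (closed_depth ts d) C' A' \<and>
      (\<forall>(S :: (nat, var) struct) i. atoms_value S i C' A' \<longleftrightarrow>
         (atoms_value S i C A \<noteq> (e \<and> linear_form es c (map (models S (i + d)) \<psi>s))))"
    if "length es = length \<psi>s" "set \<psi>s \<subseteq> set \<phi>s" for es \<psi>s c C A
    using that
  proof (induction es \<psi>s arbitrary: C A rule: list_induct2)
    case Nil
    show ?case by (intro exI[of _ "C \<noteq> (e \<and> c)"] exI[of _ A]) (auto simp: atoms_value_def)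
  next
    case (Cons e' es \<psi> \<psi>s)
    have \<psi>: "\<psi> \<in> set \<phi>s" "\<psi> \<in> formulae B" using Cons.prems \<phi>s by auto
    let ?ts = "map (\<lambda>e'. Some (e \<and> e')) es @ ts"
    from Conn.IH[OF \<psi> no_bit_concat[OF Conn.prems(2)], of \<psi>s "e \<and> e'" ?ts d "C \<noteq> (e \<and> c)" A]
    obtain C1 A1 where 1: "decide (encode \<psi> @ concat (map encode \<psi>s) @ u)
        (Some (e \<and> e') # ?ts) d (C \<noteq> (e \<and> c)) A =
      decide (concat (map encode \<psi>s) @ u) (close_scopes ?ts) (closed_depth ?ts d) C1 A1"
      "\<And>(S :: (nat, var) struct) i. atoms_value S i C1 A1 \<longleftrightarrow>
        (atoms_value S i (C \<noteq> (e \<and> c)) A \<noteq> ((e \<and> e') \<and> models S (i + d) \<psi>))"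
      by auto
    \<comment> \<open>Exclusive or is an involution: starting the induction hypothesis from
      \<open>C1 \<noteq> (e \<and> c)\<close> makes it resume with parity \<open>C1\<close>.\<close>
    have C1: "((C1 \<noteq> (e \<and> c)) \<noteq> (e \<and> c)) = C1" by auto
    from Cons.IH[of "C1 \<noteq> (e \<and> c)" A1] Cons.prems obtain C2 A2 where 2:
      "decide (concat (map encode \<psi>s) @ u) (close_scopes ?ts) (closed_depth ?ts d) C1 A1 =
        decide u (close_scopes ts) (closed_depth ts d) C2 A2"
      "\<And>(S :: (nat, var) struct) i. atoms_value S i C2 A2 \<longleftrightarrow>
        (atoms_value S i (C1 \<noteq> (e \<and> c)) A1 \<noteq> (e \<and> linear_form es c (map (models S (i + d)) \<psi>s)))"
      unfolding C1 by auto
    have flip: "atoms_value S i (C \<noteq> b) A \<longleftrightarrow> (atoms_value S i C A \<noteq> b)"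
      for S :: "(nat, var) struct" and i C b A
      by (auto simp: atoms_value_def)
    have "atoms_value S i C2 A2 \<longleftrightarrow> (atoms_value S i C A \<noteq>
        (e \<and> linear_form (e' # es) c (map (models S (i + d)) (\<psi> # \<psi>s))))"
      for S :: "(nat, var) struct" and i
      unfolding 2(2) flip 1(2) by auto
    moreover have "decide (concat (map encode (\<psi> # \<psi>s)) @ u)
        (close_scopes (map (\<lambda>e'. Some (e \<and> e')) (e' # es) @ ts))
        (closed_depth (map (\<lambda>e'. Some (e \<and> e')) (e' # es) @ ts) d) (C \<noteq> (e \<and> c)) A =
      decide u (close_scopes ts) (closed_depth ts d) C2 A2"
      using 1(1) 2(1) by simp
    ultimately show ?case by blast
  qed
  show ?case
    using args[of "coeffs_of f" \<phi>s C "const_of f" A] linear_data[OF f] len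
    by (simp add: comp_def)
qed

lemma ex_atoms_value:
  "(\<exists>(S :: (nat, var) struct) i. is_struct S \<and> atoms_value S i C A) \<longleftrightarrow> C \<or> A \<noteq> []"
proof
  assume "\<exists>(S :: (nat, var) struct) i. is_struct S \<and> atoms_value S i C A"
  then show "C \<or> A \<noteq> []" by (auto simp: atoms_value_def)
next
  assume "C \<or> A \<noteq> []"
  then consider C | "\<not> C" "A \<noteq> []" by blast
  then show "\<exists>(S :: (nat, var) struct) i. is_struct S \<and> atoms_value S i C A"
  proof cases
    case 1
    let ?S = "\<lparr>state_seq = id, var_set = {}, labelling = \<lambda>_. {}\<rparr> :: (nat, var) struct"
    have "is_struct ?S" "atoms_value ?S 0 C A" using 1 by (auto simp: is_struct_def atoms_value_def)
    then show ?thesis by blast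
  next
    case 2
    obtain d x where dx: "(d, x) \<in> set A" using 2(2) by (cases A) auto
    let ?S = "\<lparr>state_seq = id, var_set = {x}, labelling = \<lambda>i. if i = d then {x} else {}\<rparr> :: (nat, var) struct"
    have "{(d', y) \<in> set A. y \<in> labelling ?S (state_seq ?S (0 + d'))} = {(d, x)}"
      using dx by (auto split: if_splits)
    then have "atoms_value ?S 0 C A" using 2(1) unfolding atoms_value_def by simp
    moreover have "is_struct ?S" by (auto simp: is_struct_def)
    ultimately show ?thesis by blast
  qed
qed

lemma decide_correct:
  assumes "w \<in> lists (symbols B)" "B \<subseteq> linear_boolfuns"
  shows "decide w [Some True] 0 False [] \<longleftrightarrow> w \<in> SAT_X B"
proof -
  have enc: "decide (encode \<phi>) [Some True] 0 False [] \<longleftrightarrow> satisfiable \<phi>" if \<phi>: "\<phi> \<in> formulae B" for \<phi>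
  proof -
    obtain C A where CA: "decide (encode \<phi>) [Some True] 0 False [] = decide [] [] 0 C A"
      "\<And>(S :: (nat, var) struct) i. atoms_value S i C A \<longleftrightarrow>
        (atoms_value S i False [] \<noteq> models S i \<phi>)"
      using decide_encode[OF \<phi> assms(2), of "[]" True "[]" 0 False "[]"]
      by (auto simp: no_bit_def)
    have "atoms_value S i C A \<longleftrightarrow> models S i \<phi>" for S :: "(nat, var) struct" and i
      unfolding CA(2) by (simp add: atoms_value_def)
    then show ?thesis
      using CA(1) ex_atoms_value[of C A] by (simp add: satisfiable_def)
  qed
  show ?thesis
  proof
    assume dec: "decide w [Some True] 0 False []"
    obtain \<phi>s where \<phi>s: "set \<phi>s \<subseteq> formulae B" "w = concat (map encode \<phi>s)"
      "length \<phi>s = length (filter (\<lambda>t. t \<noteq> None) [Some True])"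
      using decide_parses[OF dec assms] by blast
    have "length \<phi>s = 1" unfolding \<phi>s(3) by auto
    then obtain \<phi> where "\<phi>s = [\<phi>]" by (auto simp: length_Suc_conv)
    then have "\<phi> \<in> formulae B" "w = encode \<phi>" using \<phi>s by simp_all
    then show "w \<in> SAT_X B" using dec enc by (auto simp: SAT_X_def)
  next
    assume "w \<in> SAT_X B"
    then show "decide w [Some True] 0 False []" using enc by (auto simp: SAT_X_def)
  qed
qed

section \<open>The deciding program\<close>

fun task_sym :: "bool option \<Rightarrow> 'a tsym" where
  "task_sym (Some e) = Aux (if e then 1 else 0)"
| "task_sym None = Undo"

text \<open>The order in which \<open>read_key\<close> produces it: the bits are popped from
  \<open>IN\<close> onto \<open>KEY\<close>, hence reversed, and the depth in unary goes on
  top.\<close>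

definition key :: "nat \<times> var \<Rightarrow> symbol tsym list" where
  "key a = replicate (fst a) Mark @ rev (map (Inp \<circ> BitSym) (snd a))"

text \<open>The depth is the length of the leading block of \<open>Mark\<close>, as the name
  consists of input letters only.\<close>

lemma inj_key: "inj key"
proof (rule injI)
  fix a b assume eq: "key a = key b"
  have tw: "takeWhile (\<lambda>c. c = Mark) (key a) = replicate (fst a) Mark" for a
    unfolding key_def by (subst takeWhile_append2)
      (auto simp: takeWhile_eq_Nil_iff hd_rev last_map)
  then have "fst a = fst b" using eq by (metis length_replicate)
  then show "a = b"
    using eq by (cases a; cases b) (auto simp: key_def inj_def inj_map_eq_map)
qed

lemma in_entry_key: "c \<in> set (key a) \<Longrightarrow> in_entry c"
  by (auto simp: key_def in_entry_def)

lemma Blank_key: "Blank \<notin> set (key a)"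
  using in_entry_key in_entry_simps(1) by blast

lemma map_toggle: "inj h \<Longrightarrow> map h (toggle x xs) = toggle (h x) (map h xs)"
  by (auto simp: toggle_def inj_image_mem_iff filter_map comp_def inj_eq)

definition close_scopes_prog :: "'a com" where
  "close_scopes_prog = While TASK (\<lambda>t. t = Undo) (Pop TASK ;; Pop DEPTH)"

text \<open>Popping an empty \<open>DEPTH\<close> does nothing, in agreement with the truncated
  subtraction in \<open>closed_depth\<close>.\<close>

lemma reaches_close_scopes:
  "reaches close_scopes_prog
     (mk_stacks w (map task_sym ts) (replicate d Mark) m k l r f g c e) (5 * length ts + 1) Skip
     (mk_stacks w (map task_sym (close_scopes ts)) (replicate (closed_depth ts d) Mark) m k l r f g c e)"
proof (induction ts arbitrary: d)
  case Nil
  show ?case unfolding close_scopes_prog_def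
    by (rule reaches_weaken, rule reaches_While_False) auto
next
  case (Cons t ts)
  show ?case
  proof (cases t)
    case None
    have "reaches (Pop TASK ;; Pop DEPTH)
      (mk_stacks w (map task_sym (t # ts)) (replicate d Mark) m k l r f g c e) 3 Skip
      (mk_stacks w (map task_sym ts) (replicate (d - 1) Mark) m k l r f g c e)"
      by (rule reaches_weaken[OF reaches_Seq[OF reaches_Pop reaches_Pop]])
         (cases d; simp)+
    from reaches_While_True[OF _ this Cons.IH[unfolded close_scopes_prog_def]]
    show ?thesis unfolding close_scopes_prog_def
      by (rule reaches_weaken) (use None in auto)
  next
    case (Some e)
    then show ?thesis unfolding close_scopes_prog_def
      by - (rule reaches_weaken[OF reaches_While_False], auto)
  qed
qed

text \<open>Reading the unary counter destroys it, so a second copy goes to \<open>TMP\<close>, from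
  which \<open>read_key\<close> restores it.\<close>

definition copy_depth :: "'a com" where
  "copy_depth = While DEPTH nonblank (Pop DEPTH ;; Push TMP Mark ;; Push KEY Mark)"

lemma reaches_copy_depth:
  "reaches copy_depth (mk_stacks w ts (replicate d Mark) m k l r f g c e) (9 * d + 1) Skip
     (mk_stacks w ts [] (replicate d Mark @ m) (replicate d Mark @ k) l r f g c e)"
proof (induction d arbitrary: m k)
  case 0
  show ?case unfolding copy_depth_def
    by (rule reaches_weaken, rule reaches_While_False) auto
next
  case (Suc d)
  have "reaches (Pop DEPTH ;; Push TMP Mark ;; Push KEY Mark)
      (mk_stacks w ts (replicate (Suc d) Mark) m k l r f g c e) 7 Skip
      (mk_stacks w ts (replicate d Mark) (Mark # m) (Mark # k) l r f g c e)"
    by (rule reaches_weaken[OF reaches_Seq[OF reaches_Pop reaches_Seq[OF reaches_Push reaches_Push]]])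
       simp_all
  from reaches_While_True[OF _ this Suc.IH[unfolded copy_depth_def]]
  show ?case unfolding copy_depth_def
    by (rule reaches_weaken) (auto simp: replicate_app_Cons_same)
qed

fun bit_cell :: "symbol tsym \<Rightarrow> bool" where
  "bit_cell (Inp a) = is_bit a"
| "bit_cell _ = False"

definition read_key :: "symbol com" where
  "read_key = move_while IN bit_cell KEY ;; copy_depth ;; move_all TMP DEPTH"

lemma reaches_read_key:
  "reaches read_key (mk_stacks (map Inp w) ts (replicate d Mark) [] [] l r f g c e)
     (7 * length w + 16 * d + 10) Skip
     (mk_stacks (map Inp (dropWhile is_bit w)) ts (replicate d Mark) []
        (key (d, map bit_of (takeWhile is_bit w))) l r f g c e)"
proof -
  have comp: "bit_cell \<circ> Inp = is_bit" by auto
  have bits: "map (BitSym \<circ> bit_of) (takeWhile is_bit w) = takeWhile is_bit w"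
    by (induction w) (auto elim: is_bit.elims)
  have "map (Inp \<circ> BitSym) (map bit_of (takeWhile is_bit w)) =
      map Inp (map (BitSym \<circ> bit_of) (takeWhile is_bit w))" by simp
  then have key: "key (d, map bit_of (takeWhile is_bit w)) =
      replicate d Mark @ rev (map Inp (takeWhile is_bit w))"
    by (simp only: key_def fst_conv snd_conv bits)
  show ?thesis
    unfolding read_key_def
    apply (rule reaches_weaken[OF reaches_Seq[OF reaches_move_while]])
        apply simp
       apply simp
      apply simp
      apply (rule reaches_Seq[OF reaches_copy_depth reaches_move_all])
    using length_takeWhile_le[of is_bit w]
    by (simp_all add: key takeWhile_map dropWhile_map comp)
qed

definition flip_parity :: "'a com" where
  "flip_parity = Branch PAR (\<lambda>a. if a = Blank then Push PAR Flag else Pop PAR)"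

text \<open>Emptying the input ends \<open>main_loop\<close>; \<open>ERR\<close> keeps the failure
  for the final test.\<close>

definition fail :: "'a com" where
  "fail = Push ERR Flag ;; clear IN"

text \<open>If no task is pending, \<open>t\<close> is \<open>Blank\<close>, so surplus input ends
  in \<open>fail\<close>.\<close>

definition process :: "symbol tsym \<Rightarrow> symbol tsym \<Rightarrow> symbol com" where
  "process a t = (if t = Aux 0 \<or> t = Aux 1 then
     (case a of
        Inp (ConnSym f) \<Rightarrow> Pop IN ;; Pop TASK ;; push_all TASK (map task_sym (arg_tasks (t = Aux 1) f)) ;;
          (if t = Aux 1 \<and> const_of f then flip_parity else Skip) ;; close_scopes_prog
      | Inp NextSym \<Rightarrow> Pop IN ;; Pop TASK ;; Push TASK Undo ;; Push TASK t ;; Push DEPTH Mark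
      | Inp VarSym \<Rightarrow> Pop IN ;; Pop TASK ;; read_key ;;
          (if t = Aux 1 then toggle_key else clear KEY) ;; close_scopes_prog
      | _ \<Rightarrow> fail)
     else fail)"

definition main_loop :: "symbol com" where
  "main_loop = While IN nonblank (Branch IN (\<lambda>a. Branch TASK (\<lambda>t. process a t)))"

definition config ::
    "symbol list \<Rightarrow> bool option list \<Rightarrow> nat \<Rightarrow> bool \<Rightarrow> (nat \<times> var) list \<Rightarrow> symbol stacks" where
  "config w ts d C A = mk_stacks (map Inp w) (map task_sym ts) (replicate d Mark) [] []
     (entries (map key A)) [] [] [] (if C then [Flag] else []) []"

section \<open>Cost of a single symbol\<close>

lemma reaches_main_step:
  assumes "reaches (process (Inp a) (stack_top (map task_sym ts))) (config (a # w) ts d C A) T1 Skip s1"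
    "reaches main_loop s1 T2 Skip s2"
  shows "reaches main_loop (config (a # w) ts d C A) (T1 + T2 + 4) Skip s2"
  unfolding main_loop_def
  by (rule reaches_weaken[OF reaches_While_True[OF _ reaches_Branch[OF reaches_Branch]
        assms(2)[unfolded main_loop_def]]])
     (use assms(1) in \<open>auto simp: config_def\<close>)

lemma reaches_process_Conn:
  "reaches (process (Inp (ConnSym f)) (task_sym (Some e))) (config (ConnSym f # w) (Some e # ts) d C A)
     (8 * length (coeffs_of f) + 5 * length ts + 20) Skip
     (config w (close_scopes (arg_tasks e f @ ts)) (closed_depth (arg_tasks e f @ ts) d)
       (C \<noteq> (e \<and> const_of f)) A)"
proof -
  let ?c = "\<lambda>C. if C then [Flag] else [] :: symbol tsym list"
  have flip: "reaches (if e \<and> const_of f then flip_parity else Skip)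
      (mk_stacks u v x [] [] l [] [] [] (?c C) []) 3 Skip
      (mk_stacks u v x [] [] l [] [] [] (?c (C \<noteq> (e \<and> const_of f))) [])" for u v x l
  proof (cases "e \<and> const_of f")
    case True
    show ?thesis
    proof (cases C)
      case C: True
      have "reaches flip_parity (mk_stacks u v x [] [] l [] [] [] [Flag] []) (1 + 1) Skip
         (mk_stacks u v x [] [] l [] [] [] [] [])"
        unfolding flip_parity_def
        using reaches_Pop[of PAR "mk_stacks u v x [] [] l [] [] [] [Flag] []"]
        by - (rule reaches_Branch, simp)
      from reaches_mono[OF this, of 3] show ?thesis using True C by simp
    next
      case C: False
      have "reaches flip_parity (mk_stacks u v x [] [] l [] [] [] [] []) (2 + 1) Skip
         (mk_stacks u v x [] [] l [] [] [] [Flag] [])"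
        unfolding flip_parity_def
        using reaches_Push[of PAR Flag "mk_stacks u v x [] [] l [] [] [] [] []"]
        by - (rule reaches_Branch, simp)
      from reaches_mono[OF this, of 3] show ?thesis using True C by simp
    qed
  next
    case False
    then show ?thesis by (auto simp: reaches_refl)
  qed
  note close = reaches_close_scopes[of _ "arg_tasks e f @ ts"]
  have prog: "process (Inp (ConnSym f)) (task_sym (Some e)) = Pop IN ;; Pop TASK ;;
      push_all TASK (map task_sym (arg_tasks e f)) ;;
      (if e \<and> const_of f then flip_parity else Skip) ;; close_scopes_prog"
    by (cases e) (simp_all add: process_def)
  have pushed: "reaches (push_all TASK (map task_sym (arg_tasks e f)))
      (mk_stacks u (map task_sym ts) x [] [] l [] [] [] c []) (3 * length (coeffs_of f)) Skip
      (mk_stacks u (map task_sym (arg_tasks e f @ ts)) x [] [] l [] [] [] c [])" for u x l c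
    by (rule reaches_weaken[OF reaches_push_all]) auto
  have start: "reaches (Pop TASK) ((config (ConnSym f # w) (Some e # ts) d C A)
        (IN := tl (config (ConnSym f # w) (Some e # ts) d C A IN))) 1 Skip
      (mk_stacks (map Inp w) (map task_sym ts) (replicate d Mark) [] []
        (entries (map key A)) [] [] [] (?c C) [])"
    by (rule reaches_weaken[OF reaches_Pop]) (auto simp: config_def)
  show ?thesis
    unfolding prog
    by (rule reaches_weaken[OF reaches_Seq[OF reaches_Pop reaches_Seq[OF start
          reaches_Seq[OF pushed reaches_Seq[OF flip close]]]]])
       (auto simp: config_def)
qed

lemma reaches_process_Next:
  "reaches (process (Inp NextSym) (task_sym (Some e))) (config (NextSym # w) (Some e # ts) d C A)
     12 Skip (config w (Some e # None # ts) (Suc d) C A)"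
proof -
  have prog: "process (Inp NextSym) (task_sym (Some e)) =
      Pop IN ;; Pop TASK ;; Push TASK Undo ;; Push TASK (task_sym (Some e)) ;; Push DEPTH Mark"
    by (cases e) (simp_all add: process_def)
  show ?thesis
    unfolding prog
    by (rule reaches_weaken[OF reaches_Seq[OF reaches_Pop reaches_Seq[OF reaches_Pop
          reaches_Seq[OF reaches_Push reaches_Seq[OF reaches_Push reaches_Push]]]]])
       (auto simp: config_def)
qed

text \<open>A key has length at most \<open>d + length w\<close>, which gives 21 = 7 + 14 and 30 =
  16 + 14: reading the key and toggling it.\<close>

lemma reaches_process_Var:
  fixes w A d
  defines "x \<equiv> (d, map bit_of (takeWhile is_bit w))"
  shows "reaches (process (Inp VarSym) (task_sym (Some e))) (config (VarSym # w) (Some e # ts) d C A)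
     (21 * length w + 30 * d + 36 * length (entries (map key A)) + 5 * length ts + 40) Skip
     (config (dropWhile is_bit w) (close_scopes ts) (closed_depth ts d) C
       (if e then toggle x A else A))"
proof -
  have prog: "process (Inp VarSym) (task_sym (Some e)) = Pop IN ;; Pop TASK ;; read_key ;;
     (if e then toggle_key else clear KEY) ;; close_scopes_prog"
    by (cases e) (simp_all add: process_def)
  let ?c = "\<lambda>C. if C then [Flag] else [] :: symbol tsym list"
  have len: "length (key x) \<le> d + length w"
    by (simp add: key_def x_def length_takeWhile_le)
  have start: "reaches (Pop TASK) ((config (VarSym # w) (Some e # ts) d C A)
        (IN := tl (config (VarSym # w) (Some e # ts) d C A IN))) 1 Skip
      (mk_stacks (map Inp w) (map task_sym ts) (replicate d Mark) [] []
        (entries (map key A)) [] [] [] (?c C) [])"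
    by (rule reaches_weaken[OF reaches_Pop]) (auto simp: config_def)
  have use_key: "reaches (if e then toggle_key else clear KEY)
      (mk_stacks u v y [] (key x) (entries (map key A)) [] [] [] c [])
      (36 * length (entries (map key A)) + 14 * (d + length w) + 20) Skip
      (mk_stacks u v y [] [] (entries (map key (if e then toggle x A else A))) [] [] [] c [])"
    for u v y c
  proof (cases e)
    case True
    have run: "reaches toggle_key (mk_stacks u v y [] (key x) (entries (map key A)) [] [] [] c [])
      (36 * length (entries (map key A)) + 14 * length (key x) + 20) Skip
      (mk_stacks u v y [] [] (entries (map key (toggle x A))) [] [] [] c [])"
      unfolding map_toggle[OF inj_key]
      by (rule reaches_toggle_key) (auto simp: in_entry_key Blank_key)
    show ?thesis using reaches_mono[OF run] True len by simp
  next
    case False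
    have run: "reaches (clear KEY) (mk_stacks u v y [] (key x) (entries (map key A)) [] [] [] c [])
      (3 * length (key x) + 1) Skip (mk_stacks u v y [] [] (entries (map key A)) [] [] [] c [])"
      by (rule reaches_weaken[OF reaches_clear]) (auto simp: Blank_key)
    show ?thesis using reaches_mono[OF run] False len by simp
  qed
  show ?thesis
    unfolding prog
    by (rule reaches_weaken[OF reaches_Seq[OF reaches_Pop reaches_Seq[OF start
          reaches_Seq[OF reaches_read_key[of w _ d, folded x_def] reaches_Seq[OF use_key reaches_close_scopes]]]]])
       (auto simp: config_def)
qed

lemma reaches_fail:
  "\<exists>s'. reaches fail (config w ts d C A) (3 * length w + 4) Skip s' \<and> s' IN = [] \<and> stack_top (s' ERR) \<noteq> Blank"
proof -
  let ?s = "(config w ts d C A)(ERR := [Flag], IN := [])"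
  have "reaches fail (config w ts d C A) (3 * length w + 4) Skip ?s"
    unfolding fail_def
    by (rule reaches_weaken[OF reaches_Seq[OF reaches_Push reaches_clear]])
       (auto simp: config_def)
  then show ?thesis by (intro exI[of _ ?s]) simp
qed

definition verdict :: "symbol stacks \<Rightarrow> bool" where
  "verdict s \<longleftrightarrow> stack_top (s ERR) = Blank \<and> stack_top (s TASK) = Blank \<and>
     (stack_top (s PAR) \<noteq> Blank \<or> stack_top (s ATOMS) \<noteq> Blank)"

text \<open>With at most \<open>K * n\<close> tasks, entries of total length at most
  \<open>(2 * n + 2) * n\<close>, and \<open>d\<close> and \<open>length w\<close> at most
  \<open>n\<close>: 13 = 8 + 5 from connectives, 36 from toggling, 51 = 21 + 30 from
  variables.\<close>

definition step_bound :: "nat \<Rightarrow> nat \<Rightarrow> nat" where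
  "step_bound K n = 13 * (K * n) + 36 * ((2 * n + 2) * n) + 51 * n + 60"

lemma fail_main_loop:
  assumes "process (Inp a) (stack_top (map task_sym ts)) = fail" "length (a # w) \<le> n"
    and "\<not> decide (a # w) ts d C A"
  shows "\<exists>s'. reaches main_loop (config (a # w) ts d C A) (length (a # w) * step_bound K n + 1) Skip s' \<and>
    (verdict s' \<longleftrightarrow> decide (a # w) ts d C A)"
proof -
  obtain s' where s': "reaches fail (config (a # w) ts d C A) (3 * length (a # w) + 4) Skip s'"
    "s' IN = []" "stack_top (s' ERR) \<noteq> Blank"
    using reaches_fail by blast
  have "reaches main_loop s' 1 Skip s'"
    unfolding main_loop_def by (rule reaches_While_False) (simp add: s')
  from reaches_main_step[OF s'(1)[folded assms(1)] this]
  have "reaches main_loop (config (a # w) ts d C A) (3 * length (a # w) + 4 + 1 + 4) Skip s'" .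
  moreover have "3 * length (a # w) + 8 \<le> step_bound K n"
    using assms(2) by (simp add: step_bound_def)
  then have "3 * length (a # w) + 4 + 1 + 4 \<le> length (a # w) * step_bound K n + 1"
    by simp
  ultimately have "reaches main_loop (config (a # w) ts d C A) (length (a # w) * step_bound K n + 1) Skip s'"
    by (rule reaches_mono)
  then show ?thesis using s'(3) assms(3) unfolding verdict_def by blast
qed

text \<open>The size hypotheses are potentials: unread symbols pay in advance for the growth they
  may cause. Per symbol this is \<open>K\<close> tasks (a connective pushes fewer than
  \<open>K\<close>), one level of depth, and \<open>2 * n + 2\<close> cells of
  \<open>ATOMS\<close>.\<close>

lemma reaches_main_loop:
  assumes "w \<in> lists (symbols B)" "\<forall>f\<in>B. length (coeffs_of f) + 1 \<le> K" "2 \<le> K"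
    and "length ts + K * length w \<le> K * n" "d + length w \<le> n"
    and "length (entries (map key A)) + (2 * n + 2) * length w \<le> (2 * n + 2) * n"
  shows "\<exists>s'. reaches main_loop (config w ts d C A) (length w * step_bound K n + 1) Skip s' \<and>
    (verdict s' \<longleftrightarrow> decide w ts d C A)"
  using assms(1,4-)
proof (induction w ts d C A rule: decide.induct)
  case (1 ts d C A)
  have "reaches main_loop (config [] ts d C A) 1 Skip (config [] ts d C A)"
    unfolding main_loop_def by (rule reaches_While_False) (simp add: config_def)
  moreover have "stack_top (map task_sym ts) = Blank \<longleftrightarrow> ts = []"
    by (cases ts rule: list.exhaust[case_product option.exhaust[of "hd ts"]]) auto
  \<comment> \<open>The key of the empty name at depth 0 is empty; its \<open>Sep\<close> still
    makes the stack nonblank.\<close>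
  moreover have "stack_top (entries (map key A)) = Blank \<longleftrightarrow> A = []"
  proof (cases A)
    case (Cons a A')
    then show ?thesis using Blank_key[of a] by (cases "key a") auto
  qed simp
  ultimately show ?case by (auto simp: verdict_def config_def)
next
  case (2 f w e ts d C A)
  let ?ts = "close_scopes (arg_tasks e f @ ts)" and ?d = "closed_depth (arg_tasks e f @ ts) d"
  let ?C = "C \<noteq> (e \<and> const_of f)"
  have f: "length (coeffs_of f) + 1 \<le> K" using 2(2) assms(2) by (auto simp: symbols_def)
  have "length ?ts \<le> length (coeffs_of f) + length ts"
    using length_dropWhile_le[of _ "arg_tasks e f @ ts"] by simp
  then have "length ?ts + K * length w \<le> K * n" using f 2(3) by simp
  moreover have "?d + length w \<le> n" using 2(4) by simp
  ultimately obtain s' where s': "reaches main_loop (config w ?ts ?d ?C A) (length w * step_bound K n + 1) Skip s'"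
    "verdict s' \<longleftrightarrow> decide w ?ts ?d ?C A"
    using 2(1) 2(2-) by auto
  have "K \<le> K * n" using 2(4) by simp
  moreover have "length ts \<le> K * n" using 2(3) by simp
  ultimately have "8 * length (coeffs_of f) + 5 * length ts + 24 \<le> step_bound K n"
    using f unfolding step_bound_def by linarith
  moreover have "reaches main_loop (config (ConnSym f # w) (Some e # ts) d C A)
     (8 * length (coeffs_of f) + 5 * length ts + 20 + (length w * step_bound K n + 1) + 4) Skip s'"
    by (rule reaches_main_step[OF _ s'(1)]) (simp only: list.map stack_top_simps reaches_process_Conn)
  ultimately have "reaches main_loop (config (ConnSym f # w) (Some e # ts) d C A)
     (length (ConnSym f # w) * step_bound K n + 1) Skip s'"
    by - (erule reaches_mono, simp)
  then show ?case using s'(2) by auto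
next
  case (3 w e ts d C A)
  obtain s' where s': "reaches main_loop (config w (Some e # None # ts) (Suc d) C A)
      (length w * step_bound K n + 1) Skip s'"
    "verdict s' \<longleftrightarrow> decide w (Some e # None # ts) (Suc d) C A"
    using 3 assms(3) by auto
  have "16 \<le> step_bound K n" by (simp add: step_bound_def)
  moreover have "reaches main_loop (config (NextSym # w) (Some e # ts) d C A)
     (12 + (length w * step_bound K n + 1) + 4) Skip s'"
    by (rule reaches_main_step[OF _ s'(1)]) (simp only: list.map stack_top_simps reaches_process_Next)
  ultimately have "reaches main_loop (config (NextSym # w) (Some e # ts) d C A)
     (length (NextSym # w) * step_bound K n + 1) Skip s'"
    by - (erule reaches_mono, simp)
  then show ?case using s'(2) by auto
next
  case (4 w e ts d C A)
  let ?x = "(d, map bit_of (takeWhile is_bit w))"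
  let ?w = "dropWhile is_bit w" and ?ts = "close_scopes ts" and ?d = "closed_depth ts d"
  let ?A = "if e then toggle ?x A else A"
  have w: "length ?w \<le> length w" by (rule length_dropWhile_le)
  have "length ?ts \<le> length ts" by (rule length_dropWhile_le)
  moreover have "K * length ?w \<le> K * length w" using w by simp
  moreover have "K * length (VarSym # w) = K + K * length w" by simp
  ultimately have 1: "length ?ts + K * length ?w \<le> K * n" using 4(3) unfolding length_Cons by linarith
  have 2: "?d + length ?w \<le> n" using 4(4) w by simp
  \<comment> \<open>A new entry takes its key and one separator, at most \<open>n + 1\<close> cells,
    within the budget of \<open>2 * n + 2\<close>.\<close>
  have "length (key ?x) \<le> d + length w" by (simp add: key_def length_takeWhile_le)
  then have "length (entries (map key ?A)) \<le> length (entries (map key A)) + (2 * n + 2)"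
    using length_filter_entries[of _ "map key A"] 4(4)
    unfolding if_distrib map_toggle[OF inj_key]
    by (auto simp: toggle_def intro: le_trans[OF length_filter_entries])
  moreover have "(2 * n + 2) * length ?w \<le> (2 * n + 2) * length w" using w by (rule mult_le_mono2)
  moreover have "(2 * n + 2) * length (VarSym # w) = (2 * n + 2) + (2 * n + 2) * length w" by simp
  ultimately have 3: "length (entries (map key ?A)) + (2 * n + 2) * length ?w \<le> (2 * n + 2) * n"
    using 4(5) by linarith
  have in_lists: "?w \<in> lists (symbols B)" using 4(2) by (auto dest: set_dropWhileD)
  from 4(1)[OF this 1 2 3] obtain s' where
    s': "reaches main_loop (config ?w ?ts ?d C ?A) (length ?w * step_bound K n + 1) Skip s'"
    "verdict s' \<longleftrightarrow> decide ?w ?ts ?d C ?A"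
    by blast
  have "length ts \<le> K * n" using 4(3) by simp
  moreover have "length (entries (map key A)) \<le> (2 * n + 2) * n" using 4(5) by linarith
  ultimately have "21 * length w + 30 * d + 36 * length (entries (map key A)) + 5 * length ts + 44
      \<le> step_bound K n"
    using 4(4) unfolding step_bound_def length_Cons by linarith
  moreover have "length ?w * step_bound K n \<le> length w * step_bound K n" using w by simp
  moreover have "reaches main_loop (config (VarSym # w) (Some e # ts) d C A)
     (21 * length w + 30 * d + 36 * length (entries (map key A)) + 5 * length ts + 40 +
       (length ?w * step_bound K n + 1) + 4) Skip s'"
    by (rule reaches_main_step[OF _ s'(1)]) (simp only: list.map stack_top_simps reaches_process_Var)
  ultimately have "reaches main_loop (config (VarSym # w) (Some e # ts) d C A)
     (length (VarSym # w) * step_bound K n + 1) Skip s'"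
    by - (erule reaches_mono, simp only: length_Cons mult_Suc)
  then show ?case using s'(2) by auto
qed (rule fail_main_loop; simp add: process_def)+

definition decision :: "symbol com" where
  "decision = Push TASK (Aux 1) ;; main_loop ;;
     Branch ERR (\<lambda>x. Branch TASK (\<lambda>t. Branch PAR (\<lambda>p. Branch ATOMS (\<lambda>a.
       Halt (x = Blank \<and> t = Blank \<and> (p \<noteq> Blank \<or> a \<noteq> Blank))))))"

lemma reaches_decision:
  assumes "w \<in> lists (symbols B)" "\<forall>f\<in>B. length (coeffs_of f) + 1 \<le> K" "2 \<le> K"
  shows "\<exists>s'. reaches decision ((\<lambda>_. [])(0 := map Inp w))
    (length w * step_bound K (length w + 1) + 9) (Halt (decide w [Some True] 0 False [])) s'"
proof -
  let ?s = "mk_stacks (map Inp w) [] [] [] [] [] [] [] [] [] []"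
  have init: "(\<lambda>_. [])(0 := map Inp w) = ?s"
    by (auto simp: mk_stacks_def)
  have start: "reaches (Push TASK (Aux 1)) ?s 2 Skip (config w [Some True] 0 False [])"
    by (rule reaches_weaken[OF reaches_Push]) (auto simp: config_def)
  \<comment> \<open>\<open>n\<close> is \<open>length w + 1\<close>, the extra 1 paying for the
    initial task. Of the 9 extra steps, 2 are the push, 1 ends the loop, 2 are sequencing and 4 are
    the branches.\<close>
  obtain s' where s': "reaches main_loop (config w [Some True] 0 False [])
      (length w * step_bound K (length w + 1) + 1) Skip s'"
    "verdict s' \<longleftrightarrow> decide w [Some True] 0 False []"
    using reaches_main_loop[OF assms, of "[Some True]" "length w + 1" 0 "[]" False] assms(3)
    by auto
  have "reaches (Branch ERR (\<lambda>x. Branch TASK (\<lambda>t. Branch PAR (\<lambda>p. Branch ATOMS (\<lambda>a.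
       Halt (x = Blank \<and> t = Blank \<and> (p \<noteq> Blank \<or> a \<noteq> Blank))))))) s' (0 + 1 + 1 + 1 + 1)
     (Halt (verdict s')) s'"
    unfolding verdict_def by (intro reaches_Branch reaches_refl)
  from reaches_Seq[OF start reaches_Seq[OF s'(1) this]] show ?thesis
    unfolding decision_def init s'(2) by - (intro exI, erule reaches_mono, simp)
qed

lemma wf_push_all: "wf_com k \<Gamma> (push_all i xs) \<longleftrightarrow> xs = [] \<or> i < k \<and> set xs \<subseteq> \<Gamma>"
  by (induction xs) auto

lemma wf_decision:
  assumes "Blank \<in> \<Gamma>" "Aux ` {..5} \<subseteq> \<Gamma>"
  shows "wf_com 11 \<Gamma> decision"
proof -
  have aux: "Aux i \<in> \<Gamma>" if "i \<le> 5" for i using assms that by auto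
  have task: "task_sym t \<in> \<Gamma>" for t by (cases t) (auto intro: aux)
  have "wf_com 11 \<Gamma> (process a t)" if "a \<in> \<Gamma>" "t \<in> \<Gamma>" for a t
    using that aux task
    by (auto simp: process_def close_scopes_prog_def read_key_def copy_depth_def move_while_def
        drop_while_def toggle_key_def scan_def scan_entry_def compare_def flip_parity_def fail_def
        wf_push_all split: tsym.split symbol.split)
  then show ?thesis
    using aux by (auto simp: decision_def main_loop_def)
qed

theorem theorem3p8:
  fixes B :: "boolfun set"
  assumes "finite B" and "B \<subseteq> linear_boolfuns"
  shows "poly_time_decidable (symbols B) (SAT_X B)"
proof -
  have finS: "finite (symbols B)" using assms(1) by (auto simp: symbols_def)
  \<comment> \<open>Inserting 2 keeps the maximum defined for empty \<open>B\<close> and gives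
    \<open>2 \<le> K\<close>.\<close>
  define K where "K = Max (insert 2 ((\<lambda>f. length (coeffs_of f) + 1) ` B))"
  have K: "\<forall>f\<in>B. length (coeffs_of f) + 1 \<le> K" "2 \<le> K"
    using assms(1) by (auto simp: K_def)
  \<comment> \<open>In the variable \<open>n\<close>, \<open>[:1, 1:]\<close> is
    \<open>n + 1\<close> and \<open>[:4, 2:]\<close> is \<open>2 * (n + 1) + 2\<close>, so the long
    factor is \<open>step_bound K (n + 1)\<close>.\<close>
  define p :: "nat poly" where
    "p = [:0, 1:] * ([:13 * K:] * [:1, 1:] + [:36:] * ([:4, 2:] * [:1, 1:]) + [:51:] * [:1, 1:] + [:60:]) + [:9:]"
  have p: "poly p n = n * step_bound K (n + 1) + 9" for n
    by (simp add: p_def step_bound_def algebra_simps)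
  have SAT: "SAT_X B \<subseteq> lists (symbols B)"
  proof -
    have "encode \<phi> \<in> lists (symbols B)" if "\<phi> \<in> formulae B" for \<phi>
      using that by induction (fastforce simp: symbols_def)+
    then show ?thesis by (auto simp: SAT_X_def)
  qed
  show ?thesis
  proof (rule poly_time_decidableI[where prog = decision and k = 11
        and \<Gamma> = "{Blank} \<union> Inp ` symbols B \<union> Aux ` {..5}" and p = p])
    show "\<exists>s'. reaches decision ((\<lambda>_. [])(0 := map Inp w)) (poly p (length w))
        (Halt (w \<in> SAT_X B)) s'" if "w \<in> lists (symbols B)" for w
      using reaches_decision[OF that K] decide_correct[OF that assms(2)] by (simp add: p)
    show "wf_com 11 ({Blank} \<union> Inp ` symbols B \<union> Aux ` {..5}) decision"
      by (rule wf_decision) auto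
  qed (use finS SAT in auto)
qed

end
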